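(* Let $\tau:E\to M$ be a vector bundle. There is a one-to-one correspondence between smooth left $\mathcal G_2$-actions on $E$ such that the multiplicative submonoid $(\mathbb R,\cdot)\simeq\{(a,0):a\in\mathbb R\}\subset\mathcal G_2$ acts by the homotheties of $E$ (i.e. $(a,0).v=a\,v$), and symmetric bilinear operations $\bullet:E\times_ME\to E$ such that $$v\bullet(v\bullet v)=0\qquad\text{for every } v\in E.$$ This correspondence is given by the formula $$(a,b).v=a\,v+b\,v\bullet v,\qquad (a,b)\in\mathcal G_2,\ v\in E.$$
   Context: $\mathcal G_2$ is the monoid of second jets at $0$ of maps $\phi:(\mathbb R,0)\to(\mathbb R,0)$ under composition; it is identified with $\mathbb R^2=\{(a,b)\}$ (the class of $\phi(t)=at+\frac12bt^2$), with multiplication $(a,b)(A,B)=(aA,\,aB+bA^2)$ and unit $(1,0)$. A left action satisfies $g.(g'.v)=(gg').v$ and the unit acts as the identity. Vector bundles are real and smooth (finite rank); a bilinear operation $\bullet:E\times_ME\to E$ is a smooth map which on each fiber $E_x$ restricts to an $\mathbb R$-bilinear map $E_x\times E_x\to E_x$. *)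

theory Defs
  imports "HOL-Analysis.Analysis"
begin

section \<open>Smooth manifolds\<close>

text \<open>
  Model spaces are finite-dimensional real inner product spaces, given by a type of class
  \<open>real_inner\<close> with a finite spanning set. The class \<open>euclidean_space\<close> is not used because it
  excludes dimension 0, hence 0-dimensional manifolds and bundles of rank 0.
\<close>

definition finite_dim :: "'v::real_vector itself \<Rightarrow> bool" where
  "finite_dim _ \<longleftrightarrow> (\<exists>B :: 'v set. finite B \<and> span B = UNIV)"

text \<open>
  Functions of class \<open>C\<^sup>n\<close> on an open set of a finite-dimensional space, by recursion on
  directional derivatives. Derivatives are taken unrestricted, so this is meant for open sets only.
\<close>

primrec differentiable_upto ::
  "nat \<Rightarrow> 'a::real_normed_vector set \<Rightarrow> ('a \<Rightarrow> 'b::real_normed_vector) \<Rightarrow> bool" where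
  "differentiable_upto 0 S f \<longleftrightarrow> continuous_on S f"
| "differentiable_upto (Suc n) S f \<longleftrightarrow>
     (\<forall>x\<in>S. f differentiable (at x)) \<and>
     (\<forall>v. differentiable_upto n S (\<lambda>x. frechet_derivative f (at x) v))"

definition smooth_on ::
  "'a::real_normed_vector set \<Rightarrow> ('a \<Rightarrow> 'b::real_normed_vector) \<Rightarrow> bool" where
  "smooth_on S f \<longleftrightarrow> (\<forall>n. differentiable_upto n S f)"

text \<open>
  A manifold is a topology together with a (not necessarily maximal) atlas. A chart is a pair of
  its domain and a map, whose values outside the domain are irrelevant.
\<close>

record ('a, 'm) manifold =
  mtop :: "'a topology"
  charts :: "('a set \<times> ('a \<Rightarrow> 'm)) set"

abbreviation points :: "('a, 'm, 'z) manifold_scheme \<Rightarrow> 'a set" where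
  "points M \<equiv> topspace (mtop M)"

definition is_chart :: "'a topology \<Rightarrow> 'a set \<Rightarrow> ('a \<Rightarrow> 'm::real_inner) \<Rightarrow> bool" where
  "is_chart X U \<phi> \<longleftrightarrow> openin X U \<and> open (\<phi> ` U) \<and>
     homeomorphic_map (subtopology X U) (top_of_set (\<phi> ` U)) \<phi>"

definition smooth_manifold :: "('a, 'm::real_inner) manifold \<Rightarrow> bool" where
  "smooth_manifold M \<longleftrightarrow>
     finite_dim TYPE('m) \<and> Hausdorff_space (mtop M) \<and> second_countable (mtop M) \<and>
     (\<Union>(U, \<phi>)\<in>charts M. U) = points M \<and>
     (\<forall>(U, \<phi>)\<in>charts M. is_chart (mtop M) U \<phi>) \<and>
     (\<forall>(U, \<phi>)\<in>charts M. \<forall>(V, \<psi>)\<in>charts M.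
        smooth_on (\<phi> ` (U \<inter> V)) (\<psi> \<circ> inv_into U \<phi>))"

definition smooth_map ::
  "('a, 'm::real_inner) manifold \<Rightarrow> ('b, 'n::real_inner) manifold \<Rightarrow> ('a \<Rightarrow> 'b) \<Rightarrow> bool" where
  "smooth_map M N f \<longleftrightarrow> continuous_map (mtop M) (mtop N) f \<and>
     (\<forall>(U, \<phi>)\<in>charts M. \<forall>(V, \<psi>)\<in>charts N.
        smooth_on (\<phi> ` (U \<inter> f -` V)) (\<psi> \<circ> f \<circ> inv_into U \<phi>))"

definition diffeomorphism ::
  "('a, 'm::real_inner) manifold \<Rightarrow> ('b, 'n::real_inner) manifold \<Rightarrow> ('a \<Rightarrow> 'b) \<Rightarrow> bool" where
  "diffeomorphism M N f \<longleftrightarrow> smooth_map M N f \<and>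
     (\<exists>g. smooth_map N M g \<and> (\<forall>x\<in>points M. g (f x) = x) \<and> (\<forall>y\<in>points N. f (g y) = y))"

definition euclidean_manifold :: "('m::real_inner, 'm) manifold" where
  "euclidean_manifold = \<lparr>mtop = euclidean, charts = {(UNIV, id)}\<rparr>"

definition prod_manifold ::
  "('a, 'm::real_inner) manifold \<Rightarrow> ('b, 'n::real_inner) manifold \<Rightarrow> ('a \<times> 'b, 'm \<times> 'n) manifold"
where
  "prod_manifold M N = \<lparr>mtop = prod_topology (mtop M) (mtop N),
     charts = {(U \<times> V, map_prod \<phi> \<psi>) | U \<phi> V \<psi>. (U, \<phi>) \<in> charts M \<and> (V, \<psi>) \<in> charts N}\<rparr>"

definition open_submanifold ::
  "('a, 'm::real_inner) manifold \<Rightarrow> 'a set \<Rightarrow> ('a, 'm) manifold" where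
  "open_submanifold M W = \<lparr>mtop = subtopology (mtop M) W,
     charts = {(U \<inter> W, \<phi>) | U \<phi>. (U, \<phi>) \<in> charts M}\<rparr>"


section \<open>Vector bundles\<close>

definition real_vector_space_ops ::
  "'e set \<Rightarrow> 'e \<Rightarrow> ('e \<Rightarrow> 'e \<Rightarrow> 'e) \<Rightarrow> (real \<Rightarrow> 'e \<Rightarrow> 'e) \<Rightarrow> bool" where
  "real_vector_space_ops V z add scl \<longleftrightarrow>
     z \<in> V \<and> (\<forall>u\<in>V. \<forall>v\<in>V. add u v \<in> V) \<and> (\<forall>a. \<forall>v\<in>V. scl a v \<in> V) \<and>
     (\<forall>u\<in>V. \<forall>v\<in>V. \<forall>w\<in>V. add (add u v) w = add u (add v w)) \<and>
     (\<forall>u\<in>V. \<forall>v\<in>V. add u v = add v u) \<and>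
     (\<forall>v\<in>V. add z v = v) \<and> (\<forall>v\<in>V. \<exists>w\<in>V. add v w = z) \<and>
     (\<forall>a. \<forall>u\<in>V. \<forall>v\<in>V. scl a (add u v) = add (scl a u) (scl a v)) \<and>
     (\<forall>a b. \<forall>v\<in>V. scl (a + b) v = add (scl a v) (scl b v)) \<and>
     (\<forall>a b. \<forall>v\<in>V. scl a (scl b v) = scl (a * b) v) \<and>
     (\<forall>v\<in>V. scl 1 v = v)"

text \<open>
  A bundle with total space in type \<open>'e\<close> over a base in type \<open>'p\<close>, with typical fibre \<open>'f\<close>.
  The fields \<open>vzero\<close>, \<open>vadd\<close>, \<open>vscale\<close> are the zero section and the fibrewise operations; \<open>vadd\<close>
  is irrelevant on vectors of different fibres. A pair \<open>(U, t)\<close> in \<open>trivs\<close> stands for the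
  local trivialization sending \<open>v\<close> over \<open>U\<close> to \<open>(bproj v, t v)\<close> in \<open>U \<times> 'f\<close>.
\<close>

record ('p, 'm, 'e, 'k, 'f) vbundle =
  base_mfd :: "('p, 'm) manifold"
  total_mfd :: "('e, 'k) manifold"
  bproj :: "'e \<Rightarrow> 'p"
  vzero :: "'p \<Rightarrow> 'e"
  vadd :: "'e \<Rightarrow> 'e \<Rightarrow> 'e"
  vscale :: "real \<Rightarrow> 'e \<Rightarrow> 'e"
  trivs :: "('p set \<times> ('e \<Rightarrow> 'f)) set"

abbreviation vectors :: "('p, 'm, 'e, 'k, 'f, 'z) vbundle_scheme \<Rightarrow> 'e set" where
  "vectors E \<equiv> points (total_mfd E)"

definition fibre :: "('p, 'm, 'e, 'k, 'f) vbundle \<Rightarrow> 'p \<Rightarrow> 'e set" where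
  "fibre E x = {v \<in> vectors E. bproj E v = x}"

definition local_trivialization ::
  "('p, 'm::real_inner, 'e, 'k::real_inner, 'f::real_inner) vbundle \<Rightarrow> 'p set \<Rightarrow> ('e \<Rightarrow> 'f) \<Rightarrow> bool"
where
  "local_trivialization E U t \<longleftrightarrow>
     openin (mtop (base_mfd E)) U \<and>
     diffeomorphism (open_submanifold (total_mfd E) (bproj E -` U))
       (prod_manifold (open_submanifold (base_mfd E) U) euclidean_manifold)
       (\<lambda>v. (bproj E v, t v)) \<and>
     (\<forall>x\<in>U. \<forall>v\<in>fibre E x. \<forall>w\<in>fibre E x. t (vadd E v w) = t v + t w) \<and>
     (\<forall>x\<in>U. \<forall>v\<in>fibre E x. \<forall>a. t (vscale E a v) = a *\<^sub>R t v)"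

definition vector_bundle ::
  "('p, 'm::real_inner, 'e, 'k::real_inner, 'f::real_inner) vbundle \<Rightarrow> bool" where
  "vector_bundle E \<longleftrightarrow>
     smooth_manifold (base_mfd E) \<and> smooth_manifold (total_mfd E) \<and> finite_dim TYPE('f) \<and>
     smooth_map (total_mfd E) (base_mfd E) (bproj E) \<and>
     (\<forall>x\<in>points (base_mfd E).
        real_vector_space_ops (fibre E x) (vzero E x) (vadd E) (vscale E)) \<and>
     (\<Union>(U, t)\<in>trivs E. U) = points (base_mfd E) \<and>
     (\<forall>(U, t)\<in>trivs E. local_trivialization E U t)"

text \<open>
  \<open>E \<times>\<^sub>M E\<close> with its smooth structure as the Whitney sum \<open>E \<oplus> E\<close>: a chart \<open>(W, \<phi>)\<close> of the base
  and a trivialization \<open>(U, t)\<close> give the chart \<open>(v, w) \<mapsto> (\<phi> (bproj v), t v, t w)\<close> over \<open>U \<inter> W\<close>.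
\<close>

definition fibre_square ::
  "('p, 'm::real_inner, 'e, 'k::real_inner, 'f::real_inner) vbundle
     \<Rightarrow> ('e \<times> 'e, 'm \<times> 'f \<times> 'f) manifold" where
  "fibre_square E =
     \<lparr>mtop = subtopology (prod_topology (mtop (total_mfd E)) (mtop (total_mfd E)))
               {(v, w). bproj E v = bproj E w},
      charts = {(\<Union>x\<in>U \<inter> W. fibre E x \<times> fibre E x, \<lambda>(v, w). (\<phi> (bproj E v), t v, t w))
                  | U t W \<phi>. (U, t) \<in> trivs E \<and> (W, \<phi>) \<in> charts (base_mfd E)}\<rparr>"

text \<open>
  Operations and actions are taken \<open>extensional\<close>, i.e. \<open>undefined\<close> outside their
  domains, so that equality of HOL functions is equality of maps on these domains.
\<close>

definition bilinear_operation ::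
  "('p, 'm::real_inner, 'e, 'k::real_inner, 'f::real_inner) vbundle \<Rightarrow> ('e \<times> 'e \<Rightarrow> 'e) \<Rightarrow> bool"
where
  "bilinear_operation E m \<longleftrightarrow>
     m \<in> extensional (points (fibre_square E)) \<and>
     smooth_map (fibre_square E) (total_mfd E) m \<and>
     (\<forall>x\<in>points (base_mfd E).
        (\<forall>v\<in>fibre E x. \<forall>w\<in>fibre E x. m (v, w) \<in> fibre E x) \<and>
        (\<forall>u\<in>fibre E x. \<forall>v\<in>fibre E x. \<forall>w\<in>fibre E x.
           m (vadd E u v, w) = vadd E (m (u, w)) (m (v, w)) \<and>
           m (u, vadd E v w) = vadd E (m (u, v)) (m (u, w))) \<and>
        (\<forall>a. \<forall>v\<in>fibre E x. \<forall>w\<in>fibre E x.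
           m (vscale E a v, w) = vscale E a (m (v, w)) \<and>
           m (v, vscale E a w) = vscale E a (m (v, w))))"

definition symmetric_operation ::
  "('p, 'm::real_inner, 'e, 'k::real_inner, 'f::real_inner) vbundle \<Rightarrow> ('e \<times> 'e \<Rightarrow> 'e) \<Rightarrow> bool"
where
  "symmetric_operation E m \<longleftrightarrow> (\<forall>(v, w)\<in>points (fibre_square E). m (v, w) = m (w, v))"


section \<open>The monoid of second jets and its actions\<close>

text \<open>
  \<open>(a, b)\<close> is the second jet at 0 of \<open>t \<mapsto> a t + b t\<^sup>2 / 2\<close>. The product is composition:
  substituting \<open>A t + B t\<^sup>2 / 2\<close> gives \<open>a A t + (a B + b A\<^sup>2) t\<^sup>2 / 2\<close> up to third order.
\<close>

type_synonym jet2 = "real \<times> real"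

definition jet2_mult :: "jet2 \<Rightarrow> jet2 \<Rightarrow> jet2" where
  "jet2_mult = (\<lambda>(a, b) (A, B). (a * A, a * B + b * A\<^sup>2))"

definition jet2_one :: jet2 where
  "jet2_one = (1, 0)"

definition smooth_jet2_action ::
  "('p, 'm::real_inner, 'e, 'k::real_inner, 'f::real_inner) vbundle
     \<Rightarrow> (jet2 \<times> 'e \<Rightarrow> 'e) \<Rightarrow> bool" where
  "smooth_jet2_action E act \<longleftrightarrow>
     act \<in> extensional (UNIV \<times> vectors E) \<and>
     smooth_map (prod_manifold euclidean_manifold (total_mfd E)) (total_mfd E) act \<and>
     (\<forall>v\<in>vectors E. act (jet2_one, v) = v) \<and>
     (\<forall>g h. \<forall>v\<in>vectors E. act (g, act (h, v)) = act (jet2_mult g h, v))"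

end

theory Submission
  imports Defs
begin

text \<open>
  An action \<open>act\<close> is recovered from \<open>q v = act ((0, 1), v)\<close>: since \<open>(c, 0) (a, b) = (c a, c b)\<close>, the map
  \<open>g \<mapsto> g.v\<close> is smooth and homogeneous of degree 1 from the plane to a fibre, hence linear, so
  \<open>(a, b).v = a v + b q v\<close>. Since \<open>(0, 1) (c, 0) = (c\<^sup>2, 0) (0, 1)\<close>, \<open>q\<close> is smooth and homogeneous of
  degree 2 on fibres, hence quadratic, and \<open>\<bullet>\<close> is its polarization. The relations
  \<open>(0, 1) (0, 1) = (0, 0)\<close> and \<open>(0, 1) (1, 1) = (0, 1)\<close> give \<open>v \<bullet> (v \<bullet> v) = 0\<close>. Conversely, linearizing
  this identity gives \<open>(v \<bullet> v) \<bullet> (v \<bullet> v) = 0\<close>, which makes the formula an action.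
\<close>

section \<open>Smooth functions on open sets\<close>

text \<open>Fibres are mere carrier sets with operations, so algebra and calculus are moved to the
  typical fibre by a local trivialization with an explicit inverse \<open>s\<close>. There a map
  that is homogeneous of degree 1 equals its own derivative at 0, while for degree 2 the derivative
  is homogeneous of degree 1 in the base point, so the second linearity claim reduces to the first.
  The cubic identity comes from 2 v \<bullet> q v = q (v + q v) - q v - q (q v): by the two
  relations for (0, 1) the first two terms cancel and the last one vanishes. Linearity concerns one
  fibre at a time and says nothing about dependence on the base point. Joint smoothness is read off
  the formulas themselves, and this is why addition, the projections and the diagonal of the fibre
  square have to be shown smooth for the charts made from trivializations. All of this rests on
  composing smooth maps. Model spaces carry no distinguished basis, so the chain rule is proved by
  expanding in an orthogonal spanning set.\<close>

lemma differentiable_upto_subset: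
  "differentiable_upto n S f \<Longrightarrow> T \<subseteq> S \<Longrightarrow> differentiable_upto n T f"
  by (induction n arbitrary: f) (auto intro: continuous_on_subset)

text \<open>Derivatives are taken in the whole space, so agreement on \<open>S\<close> determines
  them because \<open>S\<close> is open. This rule replaces chart expressions, which are arbitrary
  off their domains, by explicit formulas.\<close>

lemma differentiable_upto_cong:
  assumes "open S" "\<And>x. x \<in> S \<Longrightarrow> f x = g x" "differentiable_upto n S f"
  shows "differentiable_upto n S g"
  using assms(2,3)
proof (induction n arbitrary: f g)
  case 0
  then show ?case by (simp cong: continuous_on_cong)
next
  case (Suc n)
  have g: "g differentiable (at x)"
    and eq: "frechet_derivative f (at x) = frechet_derivative g (at x)" if "x \<in> S" for x
  proof -
    have f: "f differentiable (at x)" using Suc.prems(2) that by simp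
    show "frechet_derivative f (at x) = frechet_derivative g (at x)"
      by (rule frechet_derivative_transform_within_open[OF f \<open>open S\<close> that Suc.prems(1)])
    show "g differentiable (at x)"
      using f has_derivative_transform_within_open[where f = f and g = g, OF _ \<open>open S\<close> that Suc.prems(1)]
      unfolding differentiable_def by blast
  qed
  have "differentiable_upto n S (\<lambda>x. frechet_derivative g (at x) v)" for v
    by (rule Suc.IH[of "\<lambda>x. frechet_derivative f (at x) v"]) (use eq Suc.prems(2) in auto)
  then show ?case using g by simp
qed

text \<open>Uniqueness of derivatives identifies a derivative found by hand with
  \<open>frechet_derivative\<close>, which is only a choice.\<close>

lemma differentiable_upto_SucI:
  assumes "open S" and f': "\<And>x. x \<in> S \<Longrightarrow> (f has_derivative f' x) (at x)"
    and "\<And>v. differentiable_upto n S (\<lambda>x. f' x v)"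
  shows "differentiable_upto (Suc n) S f"
proof -
  have "f' x = frechet_derivative f (at x)" if "x \<in> S" for x
    using f'[OF that] by (rule frechet_derivative_at)
  then have "differentiable_upto n S (\<lambda>x. frechet_derivative f (at x) v)" for v
    by (intro differentiable_upto_cong[OF \<open>open S\<close> _ assms(3)[of v]]) auto
  then show ?thesis
    using f' by (auto simp: differentiable_def)
qed

text \<open>Product and chain rule combine derivatives, of order \<open>n\<close>, with the
  functions themselves, which must then be available at order \<open>n\<close> too.\<close>

lemma differentiable_upto_SucD:
  "differentiable_upto (Suc n) S f \<Longrightarrow> differentiable_upto n S f"
proof (induction n arbitrary: f)
  case 0
  then show ?case
    by (auto intro!: continuous_at_imp_continuous_on differentiable_imp_continuous_within)
next
  case (Suc n)
  have "differentiable_upto n S (\<lambda>x. frechet_derivative f (at x) v)" for v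
    by (rule Suc.IH) (use Suc.prems in simp)
  then show ?case using Suc.prems by simp
qed

lemma differentiable_upto_local:
  assumes "\<And>x. x \<in> S \<Longrightarrow> \<exists>T. open T \<and> x \<in> T \<and> differentiable_upto n T f"
  shows "differentiable_upto n S f"
  using assms
proof (induction n arbitrary: f)
  case 0
  then show ?case
    by (auto intro!: continuous_at_imp_continuous_on simp: continuous_on_eq_continuous_at)
      (metis continuous_on_eq_continuous_at)
next
  case (Suc n)
  have "f differentiable (at x)" if "x \<in> S" for x
    using Suc.prems[OF that] by auto
  moreover have "differentiable_upto n S (\<lambda>x. frechet_derivative f (at x) v)" for v
    using Suc.prems by (intro Suc.IH) fastforce
  ultimately show ?case by simp
qed

lemma has_derivative_frechet_derivative:
  "differentiable_upto (Suc n) S f \<Longrightarrow> x \<in> S \<Longrightarrow> (f has_derivative frechet_derivative f (at x)) (at x)"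
  by (simp add: frechet_derivative_works[symmetric])

lemma differentiable_upto_const: "open S \<Longrightarrow> differentiable_upto n S (\<lambda>x. c)"
  by (induction n arbitrary: c) (auto simp del: differentiable_upto.simps(2)
      intro!: differentiable_upto_SucI[where f' = "\<lambda>_ _. 0"] simp: continuous_on_const)

lemma differentiable_upto_bounded_linear:
  assumes "open S" "bounded_linear L"
  shows "differentiable_upto n S L"
proof (cases n)
  case 0
  then show ?thesis using assms by (simp add: linear_continuous_on)
next
  case (Suc k)
  show ?thesis
    unfolding Suc
    by (rule differentiable_upto_SucI[where f' = "\<lambda>_. L"])
      (use assms in \<open>auto intro: bounded_linear_imp_has_derivative differentiable_upto_const\<close>)
qed

lemma differentiable_upto_bounded_linear_compose:
  assumes "open S" "bounded_linear L"
  shows "differentiable_upto n S f \<Longrightarrow> differentiable_upto n S (\<lambda>x. L (f x))"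
proof (induction n arbitrary: f)
  case 0
  then show ?case by (auto intro: bounded_linear.continuous_on[OF assms(2)])
next
  case (Suc n)
  show ?case
    by (rule differentiable_upto_SucI[OF \<open>open S\<close>,
          where f' = "\<lambda>x v. L (frechet_derivative f (at x) v)"])
      (use Suc has_derivative_frechet_derivative[OF Suc.prems] in
        \<open>auto intro: bounded_linear.has_derivative[OF assms(2)]\<close>)
qed

lemma differentiable_upto_add:
  assumes "open S"
  shows "differentiable_upto n S f \<Longrightarrow> differentiable_upto n S g \<Longrightarrow> differentiable_upto n S (\<lambda>x. f x + g x)"
proof (induction n arbitrary: f g)
  case 0
  then show ?case by (auto intro: continuous_on_add)
next
  case (Suc n)
  show ?case
    by (rule differentiable_upto_SucI[OF \<open>open S\<close>,
          where f' = "\<lambda>x v. frechet_derivative f (at x) v + frechet_derivative g (at x) v"])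
      (use Suc has_derivative_frechet_derivative[OF Suc.prems(1)]
         has_derivative_frechet_derivative[OF Suc.prems(2)] in \<open>auto intro: has_derivative_add\<close>)
qed

lemma differentiable_upto_sum:
  assumes "open S" "\<And>i. i \<in> I \<Longrightarrow> differentiable_upto n S (f i)"
  shows "differentiable_upto n S (\<lambda>x. \<Sum>i\<in>I. f i x)"
  using assms(2)
  by (induction I rule: infinite_finite_induct)
    (auto intro: differentiable_upto_const differentiable_upto_add \<open>open S\<close>)

lemma differentiable_upto_bounded_bilinear:
  assumes "open S" "bounded_bilinear p"
  shows "differentiable_upto n S f \<Longrightarrow> differentiable_upto n S g \<Longrightarrow> differentiable_upto n S (\<lambda>x. p (f x) (g x))"
proof (induction n arbitrary: f g)
  case 0
  then show ?case by (auto intro: bounded_bilinear.continuous_on[OF assms(2)])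
next
  case (Suc n)
  show ?case
  proof (rule differentiable_upto_SucI[OF \<open>open S\<close>])
    show "((\<lambda>x. p (f x) (g x)) has_derivative
        (\<lambda>v. p (f x) (frechet_derivative g (at x) v) + p (frechet_derivative f (at x) v) (g x))) (at x)"
      if "x \<in> S" for x
      by (rule bounded_bilinear.FDERIV[OF assms(2)]) (use Suc.prems that in \<open>auto simp: frechet_derivative_works[symmetric]\<close>)
    show "differentiable_upto n S
        (\<lambda>x. p (f x) (frechet_derivative g (at x) v) + p (frechet_derivative f (at x) v) (g x))" for v
      using Suc.prems[THEN differentiable_upto_SucD] Suc.prems
      by (intro differentiable_upto_add Suc.IH \<open>open S\<close>) auto
  qed
qed

text \<open>The pair is the sum of the bounded linear images (f x, 0) and (0, g x).\<close>

lemma differentiable_upto_Pair: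
  assumes "open S" "differentiable_upto n S f" "differentiable_upto n S g"
  shows "differentiable_upto n S (\<lambda>x. (f x, g x))"
proof -
  have "bounded_linear (\<lambda>x. (x, 0 :: 'c))" "bounded_linear (\<lambda>y. (0 :: 'b, y))"
    by (auto intro: bounded_linear_Pair bounded_linear_ident bounded_linear_zero)
  from differentiable_upto_add[OF \<open>open S\<close>
      differentiable_upto_bounded_linear_compose[OF \<open>open S\<close> this(1) assms(2)]
      differentiable_upto_bounded_linear_compose[OF \<open>open S\<close> this(2) assms(3)]]
  show ?thesis by simp
qed

text \<open>Orthogonality turns each coefficient into an inner product with a fixed vector, hence
  into a bounded linear functional of \<open>x\<close>. The set \<open>B\<close> is not normalized
  and may contain 0, whose term vanishes.\<close>

lemma finite_dim_orthogonal_basis: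
  assumes "finite_dim TYPE('v)"
  obtains B :: "'v::real_inner set" where "finite B" "\<And>x. x = (\<Sum>b\<in>B. ((x \<bullet> b) / (b \<bullet> b)) *\<^sub>R b)"
proof -
  obtain A :: "'v set" where "finite A" "span A = UNIV"
    using assms unfolding finite_dim_def by blast
  from basis_orthogonal[OF this(1)] this(2)
  obtain B :: "'v set" where B: "finite B" "span B = UNIV" "pairwise orthogonal B"
    by metis
  have "x = (\<Sum>b\<in>B. ((x \<bullet> b) / (b \<bullet> b)) *\<^sub>R b)" for x
  proof -
    have "x \<in> span B" using B(2) by simp
    then obtain u where u: "x = (\<Sum>b\<in>B. u b *\<^sub>R b)"
      unfolding span_finite[OF B(1)] by blast
    have *: "x \<bullet> b = u b * (b \<bullet> b)" if "b \<in> B" for b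
    proof -
      have "x \<bullet> b = (\<Sum>c\<in>B. u c * (c \<bullet> b))"
        by (simp add: u inner_sum_left)
      also have "\<dots> = (\<Sum>c\<in>B. if c = b then u b * (b \<bullet> b) else 0)"
        by (intro sum.cong) (use B(3) that in \<open>auto simp: pairwise_def orthogonal_def\<close>)
      also have "\<dots> = u b * (b \<bullet> b)" using B(1) that by simp
      finally show ?thesis .
    qed
    have "((x \<bullet> b) / (b \<bullet> b)) *\<^sub>R b = u b *\<^sub>R b" if "b \<in> B" for b
      using *[OF that] by (cases "b = 0") auto
    then have "(\<Sum>b\<in>B. ((x \<bullet> b) / (b \<bullet> b)) *\<^sub>R b) = (\<Sum>b\<in>B. u b *\<^sub>R b)"
      by (intro sum.cong) auto
    then show ?thesis using u by metis
  qed
  then show thesis using that B(1) by blast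
qed

text \<open>In the derivative of the composite, \<open>x\<close> also enters the direction to which
  the derivative of \<open>g\<close> is applied, whereas the recursion controls derivatives in fixed
  directions only. Expanding that direction in the orthogonal set leaves a finite sum of smooth
  scalars times derivatives of \<open>g\<close> in fixed directions, composed with \<open>f\<close>;
  the induction hypothesis, with \<open>g\<close> arbitrary, covers these.\<close>

lemma differentiable_upto_compose:
  fixes g :: "'b::real_inner \<Rightarrow> 'c::real_normed_vector"
  assumes fd: "finite_dim TYPE('b)" and S: "open S" and T: "open T" and ST: "\<And>x. x \<in> S \<Longrightarrow> f x \<in> T"
  shows "differentiable_upto n T g \<Longrightarrow> differentiable_upto n S f \<Longrightarrow> differentiable_upto n S (\<lambda>x. g (f x))"
proof (induction n arbitrary: g)
  case 0
  then show ?case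
    using ST by (auto intro: continuous_on_compose2)
next
  case (Suc n)
  obtain B :: "'b set" where B: "finite B" "\<And>x. x = (\<Sum>b\<in>B. ((x \<bullet> b) / (b \<bullet> b)) *\<^sub>R b)"
    using finite_dim_orthogonal_basis[OF fd] by blast
  let ?Df = "\<lambda>x. frechet_derivative f (at x)" and ?Dg = "\<lambda>y. frechet_derivative g (at y)"
  have Df: "(f has_derivative ?Df x) (at x)" if "x \<in> S" for x
    using has_derivative_frechet_derivative[OF Suc.prems(2) that] .
  have Dg: "(g has_derivative ?Dg y) (at y)" if "y \<in> T" for y
    using has_derivative_frechet_derivative[OF Suc.prems(1) that] .
  show ?case
  proof (rule differentiable_upto_SucI[OF S])
    show "((\<lambda>x. g (f x)) has_derivative (\<lambda>v. ?Dg (f x) (?Df x v))) (at x)" if "x \<in> S" for x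
      by (rule has_derivative_compose[OF Df[OF that] Dg[OF ST[OF that]]])
    fix v
    have eq: "(\<Sum>b\<in>B. ((?Df x v \<bullet> b) / (b \<bullet> b)) *\<^sub>R ?Dg (f x) b) = ?Dg (f x) (?Df x v)" if "x \<in> S" for x
    proof -
      have lin: "linear (?Dg (f x))"
        by (rule has_derivative_linear[OF Dg[OF ST[OF that]]])
      show ?thesis
        by (subst B(2)[of "?Df x v"]) (simp add: linear_sum[OF lin] linear_cmul[OF lin])
    qed
    have "differentiable_upto n S (\<lambda>x. \<Sum>b\<in>B. ((?Df x v \<bullet> b) / (b \<bullet> b)) *\<^sub>R ?Dg (f x) b)"
    proof (intro differentiable_upto_sum S
        differentiable_upto_bounded_bilinear[OF S bounded_bilinear_scaleR])
      fix b :: 'b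
      have "bounded_linear (\<lambda>y. (y \<bullet> b) / (b \<bullet> b))"
        by (intro bounded_linear_divide[THEN bounded_linear_compose] bounded_linear_inner_left)
      then show "differentiable_upto n S (\<lambda>x. (?Df x v \<bullet> b) / (b \<bullet> b))"
        by (rule differentiable_upto_bounded_linear_compose[OF S]) (use Suc.prems in simp)
      show "differentiable_upto n S (\<lambda>x. ?Dg (f x) b)"
        by (rule Suc.IH) (use Suc.prems differentiable_upto_SucD[OF Suc.prems(2)] in auto)
    qed
    then show "differentiable_upto n S (\<lambda>x. ?Dg (f x) (?Df x v))"
      by (rule differentiable_upto_cong[OF S, rotated]) (rule eq)
  qed
qed

lemma finite_dim_prod:
  assumes "finite_dim TYPE('a::real_vector)" "finite_dim TYPE('b::real_vector)"
  shows "finite_dim TYPE('a \<times> 'b)"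
proof -
  obtain A :: "'a set" and B :: "'b set"
    where "finite A" "span A = UNIV" "finite B" "span B = UNIV"
    using assms unfolding finite_dim_def by blast
  moreover from this have "span (A \<times> {0} \<union> {0} \<times> B) = UNIV"
  proof -
    let ?C = "A \<times> {0} \<union> {0} \<times> B"
    have 1: "linear (\<lambda>x::'a. (x, 0::'b))" and 2: "linear (\<lambda>y::'b. (0::'a, y))"
      by (auto intro!: linearI)
    have "(x, 0) \<in> span ?C" for x
    proof -
      have "(x, 0) \<in> (\<lambda>x. (x, 0::'b)) ` span A" using \<open>span A = UNIV\<close> by auto
      also have "\<dots> = span ((\<lambda>x. (x, 0)) ` A)" by (rule linear_span_image[OF 1, symmetric])
      also have "\<dots> \<subseteq> span ?C" by (rule span_mono) auto
      finally show ?thesis .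
    qed
    moreover have "(0, y) \<in> span ?C" for y
    proof -
      have "(0, y) \<in> (\<lambda>y. (0::'a, y)) ` span B" using \<open>span B = UNIV\<close> by auto
      also have "\<dots> = span ((\<lambda>y. (0, y)) ` B)" by (rule linear_span_image[OF 2, symmetric])
      also have "\<dots> \<subseteq> span ?C" by (rule span_mono) auto
      finally show ?thesis .
    qed
    ultimately have "(x, 0) + (0, y) \<in> span ?C" for x y by (blast intro: span_add)
    then show ?thesis by auto
  qed
  ultimately show ?thesis unfolding finite_dim_def by (intro exI[of _ "A \<times> {0} \<union> {0} \<times> B"]) auto
qed

lemma finite_dim_real: "finite_dim TYPE(real)"
  unfolding finite_dim_def by (rule exI[of _ "{1}"]) (auto simp: span_singleton)

section \<open>Smoothness of all orders\<close>

lemma smooth_on_subset: "smooth_on S f \<Longrightarrow> T \<subseteq> S \<Longrightarrow> smooth_on T f"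
  unfolding smooth_on_def using differentiable_upto_subset by blast

lemma smooth_on_cong:
  assumes "open S" "\<And>x. x \<in> S \<Longrightarrow> f x = g x" "smooth_on S f"
  shows "smooth_on S g"
  using differentiable_upto_cong[of S f g, OF assms(1,2)] assms(3) unfolding smooth_on_def by blast

lemma smooth_on_local:
  assumes "\<And>x. x \<in> S \<Longrightarrow> \<exists>T. open T \<and> x \<in> T \<and> smooth_on T f"
  shows "smooth_on S f"
  using assms unfolding smooth_on_def by (intro allI differentiable_upto_local) blast

lemma smooth_on_const: "open S \<Longrightarrow> smooth_on S (\<lambda>x. c)"
  unfolding smooth_on_def by (simp add: differentiable_upto_const)

lemma smooth_on_bounded_linear: "open S \<Longrightarrow> bounded_linear L \<Longrightarrow> smooth_on S L"
  unfolding smooth_on_def by (simp add: differentiable_upto_bounded_linear)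

lemma smooth_on_add: "open S \<Longrightarrow> smooth_on S f \<Longrightarrow> smooth_on S g \<Longrightarrow> smooth_on S (\<lambda>x. f x + g x)"
  unfolding smooth_on_def by (simp add: differentiable_upto_add)

lemma smooth_on_scaleR:
  "open S \<Longrightarrow> smooth_on S f \<Longrightarrow> smooth_on S g \<Longrightarrow> smooth_on S (\<lambda>x. f x *\<^sub>R g x)"
  unfolding smooth_on_def
  by (simp add: differentiable_upto_bounded_bilinear[OF _ bounded_bilinear_scaleR])

lemma smooth_on_Pair: "open S \<Longrightarrow> smooth_on S f \<Longrightarrow> smooth_on S g \<Longrightarrow> smooth_on S (\<lambda>x. (f x, g x))"
  unfolding smooth_on_def by (simp add: differentiable_upto_Pair)

lemma smooth_on_compose:
  fixes g :: "'b::real_inner \<Rightarrow> 'c::real_normed_vector"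
  assumes "finite_dim TYPE('b)" "open S" "open T" "\<And>x. x \<in> S \<Longrightarrow> f x \<in> T"
    and "smooth_on T g" "smooth_on S f"
  shows "smooth_on S (\<lambda>x. g (f x))"
  using differentiable_upto_compose[of S T f, OF assms(1-4)] assms(5,6) unfolding smooth_on_def by blast

lemma smooth_on_differentiable: "smooth_on S f \<Longrightarrow> x \<in> S \<Longrightarrow> f differentiable (at x)"
  unfolding smooth_on_def by (auto dest!: spec[of _ 1])

lemma smooth_on_frechet_derivative:
  "smooth_on S f \<Longrightarrow> smooth_on S (\<lambda>x. frechet_derivative f (at x) v)"
  unfolding smooth_on_def by (metis differentiable_upto.simps(2))

section \<open>Smooth maps\<close>

lemma is_chart_subset: "is_chart X U \<phi> \<Longrightarrow> U \<subseteq> topspace X"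
  unfolding is_chart_def by (blast dest: openin_subset)

lemma is_chart_inj:
  assumes "is_chart X U \<phi>"
  shows "inj_on \<phi> U"
  using assms is_chart_subset[OF assms] unfolding is_chart_def homeomorphic_map_def
  by (simp add: inf.absorb2)

lemma is_chart_continuous:
  "is_chart X U \<phi> \<Longrightarrow> continuous_map (subtopology X U) euclidean \<phi>"
  unfolding is_chart_def
  by (meson homeomorphic_imp_continuous_map continuous_map_into_fulltopology)

lemma is_chart_open_image:
  assumes c: "is_chart X U \<phi>" and "openin X A" "A \<subseteq> U"
  shows "open (\<phi> ` A)"
proof -
  have "openin (subtopology X U) A"
    using assms by (simp add: openin_subset_topspace_eq openin_subtopology) blast
  moreover have "open_map (subtopology X U) (top_of_set (\<phi> ` U)) \<phi>"
    using c unfolding is_chart_def by (simp add: homeomorphic_imp_open_map)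
  ultimately have "openin (top_of_set (\<phi> ` U)) (\<phi> ` A)"
    unfolding open_map_def by blast
  then show ?thesis
    using c unfolding is_chart_def by (meson openin_open_trans)
qed

text \<open>Chart expressions are written with \<open>inv_into\<close>, which agrees with the
  inverse homeomorphism on the image of the chart.\<close>

lemma is_chart_inv_continuous:
  assumes c: "is_chart X U \<phi>"
  shows "continuous_map (top_of_set (\<phi> ` U)) X (inv_into U \<phi>)"
proof -
  obtain g where g: "homeomorphic_maps (subtopology X U) (top_of_set (\<phi> ` U)) \<phi> g"
    using c unfolding is_chart_def homeomorphic_map_maps by blast
  have "g y = inv_into U \<phi> y" if "y \<in> \<phi> ` U" for y
    using g that is_chart_inj[OF c] is_chart_subset[OF c] unfolding homeomorphic_maps_def by auto
  moreover have "continuous_map (top_of_set (\<phi> ` U)) X g"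
    using g unfolding homeomorphic_maps_def by (blast intro: continuous_map_into_fulltopology)
  ultimately show ?thesis
    by (auto intro: continuous_map_eq)
qed

lemma is_chartI:
  assumes U: "openin X U" and V: "open V"
    and \<phi>: "continuous_map (subtopology X U) euclidean \<phi>" "\<And>x. x \<in> U \<Longrightarrow> \<phi> x \<in> V"
    and g: "continuous_map (top_of_set V) X g" "\<And>y. y \<in> V \<Longrightarrow> g y \<in> U"
    and inv: "\<And>y. y \<in> V \<Longrightarrow> \<phi> (g y) = y" "\<And>x. x \<in> U \<Longrightarrow> g (\<phi> x) = x"
  shows "is_chart X U \<phi>"
proof -
  have eq: "\<phi> ` U = V"
    using \<phi>(2) g(2) inv(1) by (auto simp: image_iff) metis
  have "homeomorphic_maps (subtopology X U) (top_of_set V) \<phi> g"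
    using assms openin_subset[OF U] unfolding homeomorphic_maps_def
    by (auto intro!: continuous_map_into_subtopology)
  then show ?thesis
    using U V unfolding is_chart_def eq homeomorphic_map_maps by blast
qed

lemma is_chart_prod:
  assumes \<phi>: "is_chart X U \<phi>" and \<psi>: "is_chart Y V \<psi>"
  shows "is_chart (prod_topology X Y) (U \<times> V) (map_prod \<phi> \<psi>)"
proof -
  obtain f g where
    "homeomorphic_maps (subtopology X U) (top_of_set (\<phi> ` U)) \<phi> f"
    "homeomorphic_maps (subtopology Y V) (top_of_set (\<psi> ` V)) \<psi> g"
    using assms unfolding is_chart_def homeomorphic_map_maps by blast
  then have "homeomorphic_maps (prod_topology (subtopology X U) (subtopology Y V))
      (prod_topology (top_of_set (\<phi> ` U)) (top_of_set (\<psi> ` V))) (\<lambda>(x, y). (\<phi> x, \<psi> y)) (\<lambda>(x, y). (f x, g y))"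
    using homeomorphic_maps_prod by blast
  then have "homeomorphic_map (subtopology (prod_topology X Y) (U \<times> V))
      (top_of_set (map_prod \<phi> \<psi> ` (U \<times> V))) (map_prod \<phi> \<psi>)"
    unfolding homeomorphic_map_maps map_prod_surj_on[OF refl refl]
    by (auto simp: subtopology_Times map_prod_def)
  then show ?thesis
    using assms unfolding is_chart_def
    by (auto simp: openin_prod_Times_iff map_prod_surj_on[OF refl refl] intro: open_Times)
qed

text \<open>In use \<open>W\<close> is often a preimage, for example under \<open>bproj E\<close>,
  and such a set may contain elements outside the manifold. Hence openness is asked of its trace on
  the points.\<close>

lemma is_chart_restrict:
  assumes c: "is_chart X U \<phi>" and W: "openin X (topspace X \<inter> W)"
  shows "is_chart (subtopology X W) (U \<inter> W) \<phi>"
proof -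
  have UW: "openin X (U \<inter> W)"
  proof -
    have "U \<inter> W = U \<inter> (topspace X \<inter> W)" using is_chart_subset[OF c] by blast
    then show ?thesis using c W unfolding is_chart_def by (metis openin_Int)
  qed
  have "homeomorphic_map (subtopology X U) (top_of_set (\<phi> ` U)) \<phi>"
    using c unfolding is_chart_def by blast
  then have "homeomorphic_map (subtopology (subtopology X U) W)
     (subtopology (top_of_set (\<phi> ` U)) (\<phi> ` (U \<inter> W))) \<phi>"
    by (rule homeomorphic_map_subtopologies) (use is_chart_subset[OF c] in auto)
  then have "homeomorphic_map (subtopology X (U \<inter> W)) (top_of_set (\<phi> ` (U \<inter> W))) \<phi>"
    by (simp add: subtopology_subtopology inf.absorb2 image_mono)
  moreover have "subtopology (subtopology X W) (U \<inter> W) = subtopology X (U \<inter> W)"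
    by (simp add: subtopology_subtopology inf.absorb2)
  moreover have "openin (subtopology X W) (U \<inter> W)"
    using UW by (auto simp: openin_subtopology)
  ultimately show ?thesis
    using is_chart_open_image[OF c UW] unfolding is_chart_def by simp
qed

text \<open>The part of the manifold axioms that composing smooth maps needs: no separation or
  countability, and no compatibility of charts, which amounts to smoothness of the identity.\<close>

definition charted :: "('a, 'm::real_inner) manifold \<Rightarrow> bool" where
  "charted M \<longleftrightarrow> finite_dim TYPE('m) \<and> (\<Union>(U, \<phi>)\<in>charts M. U) = points M \<and>
     (\<forall>(U, \<phi>)\<in>charts M. is_chart (mtop M) U \<phi>)"

lemma charted_is_chart: "charted M \<Longrightarrow> (U, \<phi>) \<in> charts M \<Longrightarrow> is_chart (mtop M) U \<phi>"
  unfolding charted_def by blast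

lemma charted_chart_at:
  assumes "charted M" "p \<in> points M"
  obtains U \<phi> where "(U, \<phi>) \<in> charts M" "p \<in> U" "is_chart (mtop M) U \<phi>"
  using assms unfolding charted_def by blast

lemma smooth_manifold_charted: "smooth_manifold M \<Longrightarrow> charted M"
  unfolding smooth_manifold_def charted_def by blast

lemma charted_euclidean: "finite_dim TYPE('m) \<Longrightarrow> charted (euclidean_manifold :: ('m::real_inner, 'm) manifold)"
  unfolding charted_def euclidean_manifold_def is_chart_def by simp

lemma charted_prod:
  fixes M :: "('a, 'm::real_inner) manifold" and N :: "('b, 'n::real_inner) manifold"
  assumes M: "charted M" and N: "charted N"
  shows "charted (prod_manifold M N)"
proof -
  have "\<exists>c\<in>charts (prod_manifold M N). (x, y) \<in> fst c" if xy: "x \<in> points M" "y \<in> points N" for x y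
  proof -
    obtain U \<phi> where U: "(U, \<phi>) \<in> charts M" "x \<in> U" using charted_chart_at[OF M xy(1)] by blast
    obtain V \<psi> where V: "(V, \<psi>) \<in> charts N" "y \<in> V" using charted_chart_at[OF N xy(2)] by blast
    have "(U \<times> V, map_prod \<phi> \<psi>) \<in> charts (prod_manifold M N)"
      using U V by (auto simp: prod_manifold_def)
    then show ?thesis using U V by (auto intro!: bexI[of _ "(U \<times> V, map_prod \<phi> \<psi>)"])
  qed
  moreover have c: "is_chart (prod_topology (mtop M) (mtop N)) A \<theta>" if "(A, \<theta>) \<in> charts (prod_manifold M N)" for A \<theta>
    using that charted_is_chart[OF M] charted_is_chart[OF N]
    by (auto simp: prod_manifold_def intro: is_chart_prod)
  moreover have "A \<subseteq> points M \<times> points N" if "(A, \<theta>) \<in> charts (prod_manifold M N)" for A \<theta>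
    using is_chart_subset[OF c[OF that]] by simp
  moreover have "mtop (prod_manifold M N) = prod_topology (mtop M) (mtop N)"
    by (simp add: prod_manifold_def)
  moreover have "finite_dim TYPE('m \<times> 'n)"
    using M N by (simp add: charted_def finite_dim_prod)
  ultimately show ?thesis
    unfolding charted_def by (auto; fastforce)
qed

lemma charted_open_submanifold:
  assumes M: "charted M" and W: "openin (mtop M) (points M \<inter> W)"
  shows "charted (open_submanifold M W)"
proof -
  have "(\<Union>(U, \<phi>)\<in>charts (open_submanifold M W). U) = (\<Union>(U, \<phi>)\<in>charts M. U) \<inter> W"
    unfolding open_submanifold_def by auto
  moreover have "is_chart (subtopology (mtop M) W) U \<phi>" if "(U, \<phi>) \<in> charts (open_submanifold M W)" for U \<phi>
    using that is_chart_restrict[OF charted_is_chart[OF M] W] by (auto simp: open_submanifold_def)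
  moreover have "mtop (open_submanifold M W) = subtopology (mtop M) W"
    by (simp add: open_submanifold_def)
  ultimately show ?thesis
    using M unfolding charted_def by auto
qed

lemma mtop_simps [simp]:
  "mtop (prod_manifold M N) = prod_topology (mtop M) (mtop N)"
  "mtop (open_submanifold M W) = subtopology (mtop M) W"
  "mtop euclidean_manifold = euclidean"
  by (simp_all add: prod_manifold_def open_submanifold_def euclidean_manifold_def)

lemma smooth_map_continuous: "smooth_map M N f \<Longrightarrow> continuous_map (mtop M) (mtop N) f"
  unfolding smooth_map_def by blast

lemma smooth_map_in_points: "smooth_map M N f \<Longrightarrow> x \<in> points M \<Longrightarrow> f x \<in> points N"
  using smooth_map_continuous continuous_map_funspace by blast

lemma smooth_map_in_charts:
  "smooth_map M N f \<Longrightarrow> (U, \<phi>) \<in> charts M \<Longrightarrow> (V, \<psi>) \<in> charts N \<Longrightarrow>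
    smooth_on (\<phi> ` (U \<inter> f -` V)) (\<psi> \<circ> f \<circ> inv_into U \<phi>)"
  unfolding smooth_map_def by blast

lemma openin_chart_preimage:
  assumes "is_chart X U \<phi>" "continuous_map X Y f" "openin Y V"
  shows "openin X (U \<inter> f -` V)"
proof -
  have "openin X (U \<inter> {x \<in> topspace X. f x \<in> V})"
    using assms openin_continuous_map_preimage[OF assms(2,3)] unfolding is_chart_def by blast
  also have "U \<inter> {x \<in> topspace X. f x \<in> V} = U \<inter> f -` V"
    using is_chart_subset[OF assms(1)] by auto
  finally show ?thesis .
qed

lemma open_chart_image_preimage:
  assumes "is_chart X U \<phi>" "continuous_map X Y f" "openin Y V"
  shows "open (\<phi> ` (U \<inter> f -` V))"
  using is_chart_open_image[OF assms(1) openin_chart_preimage[OF assms]] by simp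

section \<open>Congruence, composition and products of smooth maps\<close>

lemma smooth_map_cong:
  assumes M: "charted M" and N: "charted N" and f: "smooth_map M N f"
    and eq: "\<And>x. x \<in> points M \<Longrightarrow> f x = g x"
  shows "smooth_map M N g"
  unfolding smooth_map_def
proof safe
  show "continuous_map (mtop M) (mtop N) g"
    using continuous_map_eq[OF smooth_map_continuous[OF f] eq] .
  fix U \<phi> V \<psi>
  assume U: "(U, \<phi>) \<in> charts M" and V: "(V, \<psi>) \<in> charts N"
  note cU = charted_is_chart[OF M U] and cV = charted_is_chart[OF N V]
  have *: "U \<inter> g -` V = U \<inter> f -` V" using eq is_chart_subset[OF cU] by auto
  show "smooth_on (\<phi> ` (U \<inter> g -` V)) (\<psi> \<circ> g \<circ> inv_into U \<phi>)"
    unfolding *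
  proof (rule smooth_on_cong[OF _ _ smooth_map_in_charts[OF f U V]])
    show "open (\<phi> ` (U \<inter> f -` V))"
      by (rule open_chart_image_preimage[OF cU smooth_map_continuous[OF f]])
        (use cV in \<open>simp add: is_chart_def\<close>)
    show "(\<psi> \<circ> f \<circ> inv_into U \<phi>) y = (\<psi> \<circ> g \<circ> inv_into U \<phi>) y" if "y \<in> \<phi> ` (U \<inter> f -` V)" for y
      using that is_chart_inj[OF cU] is_chart_subset[OF cU] eq by auto
  qed
qed

text \<open>The image of one chart of \<open>M\<close> need not lie in a single chart of
  \<open>N\<close>, so the argument is local. Around each point a chart of \<open>N\<close> is
  chosen at the image, and on the open set \<open>?A\<close> the expression of the composite is the
  composite of the two chart expressions.\<close>

lemma smooth_map_compose:
  fixes N :: "('b, 'n::real_inner) manifold"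
  assumes M: "charted M" and N: "charted N" and P: "charted P"
    and f: "smooth_map M N f" and g: "smooth_map N P g"
  shows "smooth_map M P (\<lambda>x. g (f x))"
  unfolding smooth_map_def
proof safe
  have cont: "continuous_map (mtop M) (mtop P) (\<lambda>x. g (f x))"
    using continuous_map_compose[OF smooth_map_continuous[OF f] smooth_map_continuous[OF g]]
    by (simp add: o_def)
  then show "continuous_map (mtop M) (mtop P) (\<lambda>x. g (f x))" .
  have fd: "finite_dim TYPE('n)" using N by (simp add: charted_def)
  fix U \<phi> V \<psi>
  assume U: "(U, \<phi>) \<in> charts M" and V: "(V, \<psi>) \<in> charts P"
  note cU = charted_is_chart[OF M U] and cV = charted_is_chart[OF P V]
  have oV: "openin (mtop P) V" using cV by (simp add: is_chart_def)
  show "smooth_on (\<phi> ` (U \<inter> (\<lambda>x. g (f x)) -` V)) (\<psi> \<circ> (\<lambda>x. g (f x)) \<circ> inv_into U \<phi>)"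
  proof (rule smooth_on_local)
    fix y assume "y \<in> \<phi> ` (U \<inter> (\<lambda>x. g (f x)) -` V)"
    then obtain p where p: "p \<in> U" "g (f p) \<in> V" "y = \<phi> p" by auto
    have "f p \<in> points N" using p is_chart_subset[OF cU] smooth_map_in_points[OF f] by blast
    then obtain W \<theta> where W: "(W, \<theta>) \<in> charts N" "f p \<in> W" and cW: "is_chart (mtop N) W \<theta>"
      using charted_chart_at[OF N] by blast
    have oW: "openin (mtop N) W" using cW by (simp add: is_chart_def)
    let ?A = "(U \<inter> f -` W) \<inter> (U \<inter> (\<lambda>x. g (f x)) -` V)"
    have "openin (mtop M) ?A"
      by (intro openin_Int openin_chart_preimage[OF cU smooth_map_continuous[OF f] oW]
          openin_chart_preimage[OF cU cont oV])
    then have oA: "open (\<phi> ` ?A)" by (rule is_chart_open_image[OF cU]) auto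
    have oB: "open (\<theta> ` (W \<inter> g -` V))"
      by (rule open_chart_image_preimage[OF cW smooth_map_continuous[OF g] oV])
    have inv: "inv_into U \<phi> (\<phi> x) = x" if "x \<in> U" for x
      using that is_chart_inj[OF cU] by simp
    have "smooth_on (\<phi> ` ?A) (\<lambda>x. (\<psi> \<circ> g \<circ> inv_into W \<theta>) ((\<theta> \<circ> f \<circ> inv_into U \<phi>) x))"
    proof (rule smooth_on_compose[OF fd oA oB _ smooth_map_in_charts[OF g W(1) V]])
      show "smooth_on (\<phi> ` ?A) (\<theta> \<circ> f \<circ> inv_into U \<phi>)"
        by (rule smooth_on_subset[OF smooth_map_in_charts[OF f U W(1)]]) auto
    qed (auto simp: inv)
    then have "smooth_on (\<phi> ` ?A) (\<psi> \<circ> (\<lambda>x. g (f x)) \<circ> inv_into U \<phi>)"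
      by (rule smooth_on_cong[OF oA, rotated]) (use is_chart_inj[OF cW] in \<open>auto simp: inv\<close>)
    then show "\<exists>T. open T \<and> y \<in> T \<and> smooth_on T (\<psi> \<circ> (\<lambda>x. g (f x)) \<circ> inv_into U \<phi>)"
      using oA p W(2) by (intro exI[of _ "\<phi> ` ?A"]) auto
  qed
qed

lemma smooth_map_Pair:
  assumes M: "charted M" and N: "charted N" and P: "charted P"
    and f: "smooth_map M N f" and g: "smooth_map M P g"
  shows "smooth_map M (prod_manifold N P) (\<lambda>x. (f x, g x))"
proof -
  have cont: "continuous_map (mtop M) (prod_topology (mtop N) (mtop P)) (\<lambda>x. (f x, g x))"
    using smooth_map_continuous[OF f] smooth_map_continuous[OF g] by (rule continuous_map_pairedI)
  have "smooth_on (\<phi> ` (U \<inter> (\<lambda>x. (f x, g x)) -` (V \<times> W))) (map_prod \<psi> \<theta> \<circ> (\<lambda>x. (f x, g x)) \<circ> inv_into U \<phi>)"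
    if U: "(U, \<phi>) \<in> charts M" and V: "(V, \<psi>) \<in> charts N" and W: "(W, \<theta>) \<in> charts P" for U \<phi> V \<psi> W \<theta>
  proof -
    note cU = charted_is_chart[OF M U] and c = charted_is_chart[OF N V] charted_is_chart[OF P W]
    have o: "open (\<phi> ` (U \<inter> (\<lambda>x. (f x, g x)) -` (V \<times> W)))" (is "open ?A")
      by (rule open_chart_image_preimage[OF cU cont]) (use c in \<open>auto simp: is_chart_def openin_prod_Times_iff\<close>)
    have "smooth_on ?A (\<lambda>y. ((\<psi> \<circ> f \<circ> inv_into U \<phi>) y, (\<theta> \<circ> g \<circ> inv_into U \<phi>) y))"
      by (intro smooth_on_Pair o smooth_on_subset[OF smooth_map_in_charts[OF f U V]]
        smooth_on_subset[OF smooth_map_in_charts[OF g U W]]) auto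
    then show ?thesis by (simp add: o_def)
  qed
  then show ?thesis
    using cont unfolding smooth_map_def by (auto simp: prod_manifold_def)
qed

text \<open>Read in charts, \<open>fst\<close> is a linear projection followed by a change of charts
  of \<open>M\<close>. Smoothness of the identity is exactly compatibility of those charts.\<close>

lemma smooth_map_fst:
  assumes M: "charted M" and N: "charted N" and id: "smooth_map M M (\<lambda>x. x)"
  shows "smooth_map (prod_manifold M N) M fst"
proof -
  have "smooth_on (map_prod \<phi> \<psi> ` (U \<times> V \<inter> fst -` U')) (\<phi>' \<circ> fst \<circ> inv_into (U \<times> V) (map_prod \<phi> \<psi>))"
    if U: "(U, \<phi>) \<in> charts M" and V: "(V, \<psi>) \<in> charts N" and U': "(U', \<phi>') \<in> charts M" for U \<phi> V \<psi> U' \<phi>'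
  proof -
    note cU = charted_is_chart[OF M U] and cV = charted_is_chart[OF N V] and cU' = charted_is_chart[OF M U']
    have fd: "finite_dim TYPE('b)" using M by (simp add: charted_def)
    have o: "open (\<phi> ` (U \<inter> (\<lambda>x. x) -` U'))"
      by (rule open_chart_image_preimage[OF cU smooth_map_continuous[OF id]]) (use cU' in \<open>simp add: is_chart_def\<close>)
    have *: "map_prod \<phi> \<psi> ` (U \<times> V \<inter> fst -` U') = \<phi> ` (U \<inter> (\<lambda>x. x) -` U') \<times> \<psi> ` V" (is "?A = ?B \<times> _")
      by (auto simp: image_iff)
    have oA: "open ?A" unfolding * using o cV by (auto simp: is_chart_def intro: open_Times)
    have inj: "inj_on (map_prod \<phi> \<psi>) (U \<times> V)"
      using is_chart_inj[OF is_chart_prod[OF cU cV]] .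
    have "smooth_on ?A (\<lambda>x. (\<phi>' \<circ> (\<lambda>x. x) \<circ> inv_into U \<phi>) (fst x))"
      by (rule smooth_on_compose[OF fd oA o _ smooth_map_in_charts[OF id U U'] smooth_on_bounded_linear[OF oA bounded_linear_fst]])
        (auto simp: *)
    then show ?thesis
      by (rule smooth_on_cong[OF oA, rotated]) (use is_chart_inj[OF cU] inj in \<open>auto simp flip: map_prod_simp\<close>)
  qed
  then show ?thesis
    unfolding smooth_map_def by (auto simp: prod_manifold_def continuous_map_fst)
qed

lemma smooth_map_snd:
  assumes M: "charted M" and N: "charted N" and id: "smooth_map N N (\<lambda>x. x)"
  shows "smooth_map (prod_manifold M N) N snd"
proof -
  have "smooth_on (map_prod \<phi> \<psi> ` (U \<times> V \<inter> snd -` V')) (\<psi>' \<circ> snd \<circ> inv_into (U \<times> V) (map_prod \<phi> \<psi>))"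
    if U: "(U, \<phi>) \<in> charts M" and V: "(V, \<psi>) \<in> charts N" and V': "(V', \<psi>') \<in> charts N" for U \<phi> V \<psi> V' \<psi>'
  proof -
    note cU = charted_is_chart[OF M U] and cV = charted_is_chart[OF N V] and cV' = charted_is_chart[OF N V']
    have fd: "finite_dim TYPE('d)" using N by (simp add: charted_def)
    have o: "open (\<psi> ` (V \<inter> (\<lambda>x. x) -` V'))"
      by (rule open_chart_image_preimage[OF cV smooth_map_continuous[OF id]]) (use cV' in \<open>simp add: is_chart_def\<close>)
    have *: "map_prod \<phi> \<psi> ` (U \<times> V \<inter> snd -` V') = \<phi> ` U \<times> \<psi> ` (V \<inter> (\<lambda>x. x) -` V')" (is "?A = _ \<times> ?B")
      by (auto simp: image_iff)
    have oA: "open ?A" unfolding * using o cU by (auto simp: is_chart_def intro: open_Times)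
    have inj: "inj_on (map_prod \<phi> \<psi>) (U \<times> V)"
      using is_chart_inj[OF is_chart_prod[OF cU cV]] .
    have "smooth_on ?A (\<lambda>x. (\<psi>' \<circ> (\<lambda>x. x) \<circ> inv_into V \<psi>) (snd x))"
      by (rule smooth_on_compose[OF fd oA o _ smooth_map_in_charts[OF id V V'] smooth_on_bounded_linear[OF oA bounded_linear_snd]])
        (auto simp: *)
    then show ?thesis
      by (rule smooth_on_cong[OF oA, rotated]) (use is_chart_inj[OF cV] inj in \<open>auto simp flip: map_prod_simp\<close>)
  qed
  then show ?thesis
    unfolding smooth_map_def by (auto simp: prod_manifold_def continuous_map_snd)
qed

lemma smooth_map_id:
  assumes "smooth_manifold M"
  shows "smooth_map M M (\<lambda>x. x)"
  using assms unfolding smooth_manifold_def smooth_map_def by (auto simp: o_def)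

lemma smooth_map_const:
  assumes M: "charted M" and N: "charted N" and c: "c \<in> points N"
  shows "smooth_map M N (\<lambda>x. c)"
proof -
  have cont: "continuous_map (mtop M) (mtop N) (\<lambda>x. c)" using c by simp
  have "smooth_on (\<phi> ` (U \<inter> (\<lambda>x. c) -` V)) (\<psi> \<circ> (\<lambda>x. c) \<circ> inv_into U \<phi>)"
    if "(U, \<phi>) \<in> charts M" "(V, \<psi>) \<in> charts N" for U \<phi> V \<psi>
    using open_chart_image_preimage[OF charted_is_chart[OF M that(1)] cont] charted_is_chart[OF N that(2)]
    unfolding comp_def is_chart_def by (blast intro: smooth_on_const)
  then show ?thesis using cont unfolding smooth_map_def by blast
qed

section \<open>Open submanifolds and locality\<close>

lemma smooth_map_restrict:
  assumes M: "charted M" and N: "charted N" and W: "openin (mtop M) (points M \<inter> W)" and f: "smooth_map M N f"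
  shows "smooth_map (open_submanifold M W) N f"
proof -
  have cont: "continuous_map (subtopology (mtop M) W) (mtop N) f"
    using smooth_map_continuous[OF f] by (rule continuous_map_from_subtopology)
  have "smooth_on (\<phi> ` (U \<inter> W \<inter> f -` V)) (\<psi> \<circ> f \<circ> inv_into (U \<inter> W) \<phi>)"
    if U: "(U, \<phi>) \<in> charts M" and V: "(V, \<psi>) \<in> charts N" for U \<phi> V \<psi>
  proof -
    note cU = charted_is_chart[OF M U] and cV = charted_is_chart[OF N V]
    have o: "open (\<phi> ` (U \<inter> W \<inter> f -` V))"
      by (rule open_chart_image_preimage[OF is_chart_restrict[OF cU W] cont]) (use cV in \<open>simp add: is_chart_def\<close>)
    have "smooth_on (\<phi> ` (U \<inter> W \<inter> f -` V)) (\<psi> \<circ> f \<circ> inv_into U \<phi>)"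
      by (rule smooth_on_subset[OF smooth_map_in_charts[OF f U V]]) auto
    then show ?thesis
      by (rule smooth_on_cong[OF o, rotated]) (use is_chart_inj[OF cU] in \<open>auto simp: inj_on_Int\<close>)
  qed
  then show ?thesis
    using cont unfolding smooth_map_def by (auto simp: open_submanifold_def)
qed

lemma smooth_map_into_open_submanifold:
  assumes f: "smooth_map M N f" and W: "\<And>x. x \<in> points M \<Longrightarrow> f x \<in> W"
  shows "smooth_map M (open_submanifold N W) f"
proof -
  have "smooth_on (\<phi> ` (U \<inter> f -` (V \<inter> W))) (\<psi> \<circ> f \<circ> inv_into U \<phi>)"
    if U: "(U, \<phi>) \<in> charts M" and V: "(V, \<psi>) \<in> charts N" for U \<phi> V \<psi>
    by (rule smooth_on_subset[OF smooth_map_in_charts[OF f U V]]) auto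
  moreover have "continuous_map (mtop M) (subtopology (mtop N) W) f"
    using smooth_map_continuous[OF f] W by (auto intro: continuous_map_into_subtopology)
  ultimately show ?thesis
    unfolding smooth_map_def by (auto simp: open_submanifold_def)
qed

lemma smooth_map_local:
  assumes M: "charted M" and N: "charted N"
    and loc: "\<And>p. p \<in> points M \<Longrightarrow> \<exists>W. openin (mtop M) (points M \<inter> W) \<and> p \<in> W \<and> smooth_map (open_submanifold M W) N f"
  shows "smooth_map M N f"
  unfolding smooth_map_def
proof safe
  show "continuous_map (mtop M) (mtop N) f"
    unfolding continuous_map_def
  proof safe
    show "f p \<in> points N" if "p \<in> points M" for p
      using loc[OF that] that by (auto dest: smooth_map_in_points)
    fix V assume V: "openin (mtop N) V"
    show "openin (mtop M) {x \<in> points M. f x \<in> V}"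
    proof (subst openin_subopen, safe)
      fix p assume p: "p \<in> points M" "f p \<in> V"
      obtain W where W: "openin (mtop M) (points M \<inter> W)" "p \<in> W"
        and f: "smooth_map (open_submanifold M W) N f" using loc[OF p(1)] by blast
      have "openin (subtopology (mtop M) W) {x \<in> topspace (subtopology (mtop M) W). f x \<in> V}"
        using openin_continuous_map_preimage[OF smooth_map_continuous[OF f] V] by simp
      then obtain T where "openin (mtop M) T" "{x \<in> topspace (subtopology (mtop M) W). f x \<in> V} = T \<inter> W"
        unfolding openin_subtopology by blast
      \<comment> \<open>An open set \<open>T\<close> consists of points of \<open>M\<close>, so
        \<open>W\<close> may be replaced by its trace on the points, which is open in
        \<open>M\<close> itself.\<close>
      then have "{x \<in> points M \<inter> W. f x \<in> V} = T \<inter> (points M \<inter> W)"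
        using openin_subset by fastforce
      then have "openin (mtop M) {x \<in> points M \<inter> W. f x \<in> V}"
        using \<open>openin (mtop M) T\<close> W(1) by (metis openin_Int)
      then show "\<exists>T. openin (mtop M) T \<and> p \<in> T \<and> T \<subseteq> {x \<in> points M. f x \<in> V}"
        using p W by (intro exI[of _ "{x \<in> points M \<inter> W. f x \<in> V}"]) auto
    qed
  qed
  fix U \<phi> V \<psi>
  assume U: "(U, \<phi>) \<in> charts M" and V: "(V, \<psi>) \<in> charts N"
  note cU = charted_is_chart[OF M U] and cV = charted_is_chart[OF N V]
  show "smooth_on (\<phi> ` (U \<inter> f -` V)) (\<psi> \<circ> f \<circ> inv_into U \<phi>)"
  proof (rule smooth_on_local)
    fix y assume "y \<in> \<phi> ` (U \<inter> f -` V)"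
    then obtain p where p: "p \<in> U" "f p \<in> V" "y = \<phi> p" by auto
    then obtain W where W: "openin (mtop M) (points M \<inter> W)" "p \<in> W"
      and f: "smooth_map (open_submanifold M W) N f"
      using loc is_chart_subset[OF cU] by blast
    have o: "open (\<phi> ` (U \<inter> W \<inter> f -` V))"
      by (rule open_chart_image_preimage[OF is_chart_restrict[OF cU W(1)]])
        (use smooth_map_continuous[OF f] cV in \<open>auto simp: is_chart_def\<close>)
    have "(U \<inter> W, \<phi>) \<in> charts (open_submanifold M W)"
      using U by (auto simp: open_submanifold_def)
    from smooth_map_in_charts[OF f this V]
    have "smooth_on (\<phi> ` (U \<inter> W \<inter> f -` V)) (\<psi> \<circ> f \<circ> inv_into U \<phi>)"
      by (rule smooth_on_cong[OF o, rotated]) (use is_chart_inj[OF cU] in \<open>auto simp: inj_on_Int\<close>)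
    then show "\<exists>T. open T \<and> y \<in> T \<and> smooth_on T (\<psi> \<circ> f \<circ> inv_into U \<phi>)"
      using o p W(2) by (intro exI[of _ "\<phi> ` (U \<inter> W \<inter> f -` V)"]) auto
  qed
qed

section \<open>Maps with values in a model space\<close>

lemma smooth_map_euclidean_iff:
  "smooth_map euclidean_manifold euclidean_manifold f \<longleftrightarrow> smooth_on UNIV f"
proof -
  have "continuous_on UNIV f" if "smooth_on UNIV f"
    using that unfolding smooth_on_def by (metis differentiable_upto.simps(1))
  then show ?thesis
    unfolding smooth_map_def by (auto simp: euclidean_manifold_def)
qed

lemma smooth_id_euclidean: "smooth_map euclidean_manifold euclidean_manifold (\<lambda>x. x)"
  unfolding smooth_map_euclidean_iff by (intro smooth_on_bounded_linear open_UNIV bounded_linear_ident)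

text \<open>An honest equality, since the product atlas again consists of the identity chart alone.
  It makes pairs of vector-valued maps into maps to one model space, where sums and multiples are
  handled by \<open>smooth_on\<close>.\<close>

lemma prod_euclidean_manifold:
  "prod_manifold euclidean_manifold euclidean_manifold = euclidean_manifold"
  by (simp add: prod_manifold_def euclidean_manifold_def map_prod.id)

lemma smooth_map_add:
  fixes f g :: "'a \<Rightarrow> 'v::real_inner"
  assumes M: "charted M" and v: "finite_dim TYPE('v)"
    and f: "smooth_map M euclidean_manifold f" and g: "smooth_map M euclidean_manifold g"
  shows "smooth_map M euclidean_manifold (\<lambda>x. f x + g x)"
proof -
  note e = charted_euclidean[OF v]
  have "smooth_on UNIV (\<lambda>p :: 'v \<times> 'v. fst p + snd p)"
    by (intro smooth_on_add smooth_on_bounded_linear bounded_linear_fst bounded_linear_snd open_UNIV)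
  from smooth_map_compose[OF M _ e smooth_map_Pair[OF M e e f g, unfolded prod_euclidean_manifold]
      this[folded smooth_map_euclidean_iff]]
  show ?thesis by (simp add: charted_euclidean finite_dim_prod v)
qed

lemma smooth_map_scaleR:
  fixes f :: "'a \<Rightarrow> 'v::real_inner"
  assumes M: "charted M" and v: "finite_dim TYPE('v)"
    and c: "smooth_map M euclidean_manifold c" and f: "smooth_map M euclidean_manifold f"
  shows "smooth_map M euclidean_manifold (\<lambda>x. c x *\<^sub>R f x)"
proof -
  note e = charted_euclidean[OF finite_dim_real] charted_euclidean[OF v]
  have "smooth_on UNIV (\<lambda>p :: real \<times> 'v. fst p *\<^sub>R snd p)"
    by (intro smooth_on_scaleR smooth_on_bounded_linear bounded_linear_fst bounded_linear_snd open_UNIV)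
  from smooth_map_compose[OF M _ e(2) smooth_map_Pair[OF M e c f, unfolded prod_euclidean_manifold]
      this[folded smooth_map_euclidean_iff]]
  show ?thesis by (simp add: charted_euclidean finite_dim_prod finite_dim_real v)
qed

section \<open>Local trivializations\<close>

text \<open>A local trivialization only asserts that a smooth inverse exists. Making
  \<open>s\<close> a parameter turns coordinates into vectors by an explicit map, with its
  smoothness at hand.\<close>

locale trivialized =
  fixes E :: "('p, 'm::real_inner, 'e, 'k::real_inner, 'f::real_inner) vbundle"
    and U :: "'p set" and t :: "'e \<Rightarrow> 'f" and s :: "'p \<times> 'f \<Rightarrow> 'e"
  assumes vb: "vector_bundle E"
    and open_U: "openin (mtop (base_mfd E)) U"
    and smooth_triv: "smooth_map (open_submanifold (total_mfd E) (bproj E -` U))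
       (prod_manifold (open_submanifold (base_mfd E) U) euclidean_manifold) (\<lambda>v. (bproj E v, t v))"
    and smooth_inv: "smooth_map (prod_manifold (open_submanifold (base_mfd E) U) euclidean_manifold)
      (open_submanifold (total_mfd E) (bproj E -` U)) s"
    and inv_triv: "v \<in> vectors E \<Longrightarrow> bproj E v \<in> U \<Longrightarrow> s (bproj E v, t v) = v"
    and bproj_inv: "x \<in> U \<Longrightarrow> bproj E (s (x, y)) = x"
    and triv_inv: "x \<in> U \<Longrightarrow> t (s (x, y)) = y"
    and triv_add: "x \<in> U \<Longrightarrow> v \<in> fibre E x \<Longrightarrow> w \<in> fibre E x \<Longrightarrow> t (vadd E v w) = t v + t w"
    and triv_scale: "x \<in> U \<Longrightarrow> v \<in> fibre E x \<Longrightarrow> t (vscale E a v) = a *\<^sub>R t v"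

lemma trivialized_exists:
  assumes vb: "vector_bundle E" and U: "(U, t) \<in> trivs E"
  shows "\<exists>s. trivialized E U t s"
proof -
  have l: "local_trivialization E U t" using assms unfolding vector_bundle_def by blast
  then have oU: "openin (mtop (base_mfd E)) U" unfolding local_trivialization_def by blast
  obtain s where s: "smooth_map (prod_manifold (open_submanifold (base_mfd E) U) euclidean_manifold)
      (open_submanifold (total_mfd E) (bproj E -` U)) s"
    "\<And>v. v \<in> vectors E \<Longrightarrow> bproj E v \<in> U \<Longrightarrow> s (bproj E v, t v) = v"
    "\<And>x y. x \<in> points (base_mfd E) \<Longrightarrow> x \<in> U \<Longrightarrow> (bproj E (s (x, y)), t (s (x, y))) = (x, y)"
    using l unfolding local_trivialization_def diffeomorphism_def by auto
  have "trivialized E U t s"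
    using vb l s openin_subset[OF oU] unfolding local_trivialization_def diffeomorphism_def
    by unfold_locales auto
  then show ?thesis by blast
qed

lemma trivialized_at:
  assumes "vector_bundle E" "x \<in> points (base_mfd E)"
  obtains U t s where "trivialized E U t s" "x \<in> U"
proof -
  obtain U t where "(U, t) \<in> trivs E" "x \<in> U" using assms unfolding vector_bundle_def by blast
  with trivialized_exists[OF assms(1)] that show thesis by blast
qed

context
  fixes E :: "('p, 'm::real_inner, 'e, 'k::real_inner, 'f::real_inner) vbundle"
  assumes vb: "vector_bundle E"
begin

lemma charted_base: "charted (base_mfd E)" and charted_total: "charted (total_mfd E)"
  and finite_dim_fibre: "finite_dim TYPE('f)"
  and smooth_bproj: "smooth_map (total_mfd E) (base_mfd E) (bproj E)"
  and smooth_id_total: "smooth_map (total_mfd E) (total_mfd E) (\<lambda>x. x)"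
  using vb unfolding vector_bundle_def by (simp_all add: smooth_manifold_charted smooth_map_id)

lemma bproj_in_base: "v \<in> vectors E \<Longrightarrow> bproj E v \<in> points (base_mfd E)"
  using smooth_map_in_points[OF smooth_bproj] .

lemma charted_euclidean_fibre: "charted (euclidean_manifold :: ('f, 'f) manifold)"
  by (rule charted_euclidean[OF finite_dim_fibre])

lemma vspace: "x \<in> points (base_mfd E) \<Longrightarrow> real_vector_space_ops (fibre E x) (vzero E x) (vadd E) (vscale E)"
  using vb unfolding vector_bundle_def by blast

end

lemma openin_preimage_points:
  assumes "continuous_map X Y f" "openin Y U"
  shows "openin X (topspace X \<inter> f -` U)"
  using openin_continuous_map_preimage[OF assms] by (simp add: Collect_conj_eq vimage_def)

context trivialized
begin

lemmas charted = charted_base[OF vb] charted_total[OF vb] charted_euclidean_fibre[OF vb]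

lemma U_subset: "U \<subseteq> points (base_mfd E)"
  using openin_subset[OF open_U] .

lemma open_over: "openin (mtop (total_mfd E)) (vectors E \<inter> bproj E -` U)"
  using openin_preimage_points[OF smooth_map_continuous[OF smooth_bproj[OF vb]] open_U] .

lemma charted_over: "charted (open_submanifold (total_mfd E) (bproj E -` U))"
  by (rule charted_open_submanifold[OF charted(2) open_over])

lemma open_base: "openin (mtop (base_mfd E)) (points (base_mfd E) \<inter> U)"
  using open_U U_subset by (simp add: inf.absorb2)

lemma charted_base_U: "charted (open_submanifold (base_mfd E) U)"
  by (rule charted_open_submanifold[OF charted(1) open_base])

lemma smooth_inv_total: "smooth_map (prod_manifold (open_submanifold (base_mfd E) U) euclidean_manifold)
      (total_mfd E) s"
  by (rule smooth_map_compose[OF charted_prod[OF charted_base_U charted(3)] charted_over charted(2)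
    smooth_inv smooth_map_restrict[OF charted(2) charted(2) open_over smooth_id_total[OF vb]]])

lemma smooth_t: "smooth_map (open_submanifold (total_mfd E) (bproj E -` U)) euclidean_manifold t"
  using smooth_map_compose[OF charted_over charted_prod[OF charted_base_U charted(3)] charted(3) smooth_triv
      smooth_map_snd[OF charted_base_U charted(3) smooth_id_euclidean]]
  by simp

lemma inv_in_vectors: "x \<in> U \<Longrightarrow> s (x, y) \<in> vectors E"
  using smooth_map_in_points[OF smooth_inv_total, of "(x, y)"] U_subset by auto

lemma inv_in_fibre: "x \<in> U \<Longrightarrow> s (x, y) \<in> fibre E x"
  by (simp add: fibre_def inv_in_vectors bproj_inv)

lemma inv_triv_fibre: "x \<in> U \<Longrightarrow> v \<in> fibre E x \<Longrightarrow> s (x, t v) = v"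
  unfolding fibre_def using inv_triv by blast

lemma triv_eqI: "x \<in> U \<Longrightarrow> v \<in> fibre E x \<Longrightarrow> w \<in> fibre E x \<Longrightarrow> t v = t w \<Longrightarrow> v = w"
  by (metis inv_triv_fibre)

lemma smooth_map_triv:
  assumes N: "charted N" and f: "smooth_map N (total_mfd E) f" and "\<And>x. x \<in> points N \<Longrightarrow> bproj E (f x) \<in> U"
  shows "smooth_map N euclidean_manifold (\<lambda>x. t (f x))"
  by (rule smooth_map_compose[OF N charted_over charted(3) smooth_map_into_open_submanifold[OF f] smooth_t])
    (use assms(3) in simp)

lemma smooth_map_inv:
  assumes N: "charted N" and p: "smooth_map N (base_mfd E) p" and pU: "\<And>x. x \<in> points N \<Longrightarrow> p x \<in> U"
    and y: "smooth_map N euclidean_manifold y"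
  shows "smooth_map N (total_mfd E) (\<lambda>x. s (p x, y x))"
  by (rule smooth_map_compose[OF N charted_prod[OF charted_base_U charted(3)] charted(2)
     smooth_map_Pair[OF N charted_base_U charted(3) smooth_map_into_open_submanifold[OF p pU] y] smooth_inv_total])

end

section \<open>The fibre square\<close>

lemma points_fibre_square:
  "points (fibre_square E) = {(v, w). v \<in> vectors E \<and> w \<in> vectors E \<and> bproj E v = bproj E w}"
  by (auto simp: fibre_square_def)

lemma mtop_fibre_square:
  "mtop (fibre_square E) = subtopology (prod_topology (mtop (total_mfd E)) (mtop (total_mfd E)))
     {(v, w). bproj E v = bproj E w}"
  by (simp add: fibre_square_def)

definition square_dom :: "('p, 'm::real_inner, 'e, 'k::real_inner, 'f::real_inner) vbundle \<Rightarrow> 'p set \<Rightarrow> ('e \<times> 'e) set" where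
  "square_dom E A = (\<Union>x\<in>A. fibre E x \<times> fibre E x)"

definition square_map :: "('p, 'm::real_inner, 'e, 'k::real_inner, 'f::real_inner) vbundle
    \<Rightarrow> ('p \<Rightarrow> 'm) \<Rightarrow> ('e \<Rightarrow> 'f) \<Rightarrow> 'e \<times> 'e \<Rightarrow> 'm \<times> 'f \<times> 'f" where
  "square_map E \<phi> t = (\<lambda>(v, w). (\<phi> (bproj E v), t v, t w))"

lemma charts_fibre_square:
  "charts (fibre_square E) = {(square_dom E (U \<inter> W), square_map E \<phi> t)
     | U t W \<phi>. (U, t) \<in> trivs E \<and> (W, \<phi>) \<in> charts (base_mfd E)}"
  by (simp add: fibre_square_def square_dom_def square_map_def)

lemma square_dom_iff: "(v, w) \<in> square_dom E A \<longleftrightarrow> v \<in> vectors E \<and> w \<in> vectors E \<and> bproj E v = bproj E w \<and> bproj E v \<in> A"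
  by (auto simp: square_dom_def fibre_def)

context trivialized
begin

section \<open>Charts of the fibre square over a trivialized base chart\<close>

context
  fixes W \<phi>
  assumes W: "(W, \<phi>) \<in> charts (base_mfd E)"
begin

abbreviation "square_inv \<equiv> \<lambda>(x, y, z). (s (inv_into W \<phi> x, y), s (inv_into W \<phi> x, z))"

lemma chart_W: "is_chart (mtop (base_mfd E)) W \<phi>"
  by (rule charted_is_chart[OF charted(1) W])

lemma inv_W: "x \<in> W \<Longrightarrow> inv_into W \<phi> (\<phi> x) = x"
  using is_chart_inj[OF chart_W] by simp

lemma open_UW: "openin (mtop (base_mfd E)) (U \<inter> W)"
  using open_U chart_W unfolding is_chart_def by blast

lemma square_map_inv:
  assumes "p \<in> \<phi> ` (U \<inter> W) \<times> UNIV"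
  shows "square_inv p \<in> square_dom E (U \<inter> W)" "square_map E \<phi> t (square_inv p) = p"
  using assms by (auto simp: inv_W square_dom_iff square_map_def inv_in_vectors bproj_inv triv_inv)

lemma square_inv_map: "p \<in> square_dom E (U \<inter> W) \<Longrightarrow> square_inv (square_map E \<phi> t p) = p"
  by (cases p) (auto simp: square_dom_iff square_map_def inv_W inv_triv, metis inv_triv)

lemma square_map_in: "p \<in> square_dom E (U \<inter> W) \<Longrightarrow> square_map E \<phi> t p \<in> \<phi> ` (U \<inter> W) \<times> UNIV"
  by (cases p) (auto simp: square_dom_iff square_map_def)

lemma continuous_inv_W: "continuous_map (top_of_set (\<phi> ` (U \<inter> W))) (mtop (base_mfd E)) (inv_into W \<phi>)"
  by (rule continuous_map_from_subtopology_mono[OF is_chart_inv_continuous[OF chart_W]]) auto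

lemma continuous_triv_square:
  "continuous_map (subtopology (mtop (fibre_square E)) (square_dom E (U \<inter> W))) euclidean (square_map E \<phi> t)"
proof -
  let ?X = "subtopology (mtop (fibre_square E)) (square_dom E (U \<inter> W))"
  have f: "continuous_map ?X (mtop (total_mfd E)) fst" "continuous_map ?X (mtop (total_mfd E)) snd"
    unfolding mtop_fibre_square
    by (intro continuous_map_from_subtopology continuous_map_fst continuous_map_snd)+
  have "continuous_map ?X (mtop (open_submanifold (total_mfd E) (bproj E -` U))) fst"
    "continuous_map ?X (mtop (open_submanifold (total_mfd E) (bproj E -` U))) snd"
    using f by (auto intro!: continuous_map_into_subtopology simp: square_dom_iff)
  from this[THEN continuous_map_compose, OF smooth_map_continuous[OF smooth_t]]
  have t: "continuous_map ?X euclidean (t \<circ> fst)" "continuous_map ?X euclidean (t \<circ> snd)" by simp_all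
  have "continuous_map ?X (mtop (base_mfd E)) (bproj E \<circ> fst)"
    by (rule continuous_map_compose[OF f(1) smooth_map_continuous[OF smooth_bproj[OF vb]]])
  then have "continuous_map ?X (subtopology (mtop (base_mfd E)) W) (bproj E \<circ> fst)"
    by (auto intro!: continuous_map_into_subtopology simp: square_dom_iff)
  from continuous_map_compose[OF this is_chart_continuous[OF chart_W]]
  have "continuous_map ?X euclidean (\<phi> \<circ> (bproj E \<circ> fst))" .
  from continuous_map_pairedI[OF this continuous_map_pairedI[OF t]]
  show ?thesis by (simp add: square_map_def o_def case_prod_unfold)
qed

lemma continuous_square_inv:
  "continuous_map (top_of_set (\<phi> ` (U \<inter> W) \<times> UNIV)) (mtop (fibre_square E)) square_inv"
proof -
  let ?Y = "top_of_set (\<phi> ` (U \<inter> W) \<times> (UNIV :: ('f \<times> 'f) set))"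
  have "continuous_map ?Y (top_of_set (\<phi> ` (U \<inter> W))) fst"
    by (auto intro!: continuous_map_into_subtopology continuous_intros)
  from continuous_map_compose[OF this continuous_inv_W]
  have "continuous_map ?Y (subtopology (mtop (base_mfd E)) U) (\<lambda>p. inv_into W \<phi> (fst p))"
    by (auto intro!: continuous_map_into_subtopology simp: inv_W o_def)
  then have *: "continuous_map ?Y (prod_topology (subtopology (mtop (base_mfd E)) U) euclidean) (\<lambda>p. (inv_into W \<phi> (fst p), h p))"
    if "continuous_on UNIV h" for h :: "'m \<times> 'f \<times> 'f \<Rightarrow> 'f"
    using that by (intro continuous_map_pairedI) (auto intro: continuous_on_subset)
  have "continuous_map ?Y (mtop (total_mfd E)) (\<lambda>p. s (inv_into W \<phi> (fst p), h p))"
    if "continuous_on UNIV h" for h :: "'m \<times> 'f \<times> 'f \<Rightarrow> 'f"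
    using continuous_map_compose[OF *[OF that], of "mtop (total_mfd E)" s] smooth_map_continuous[OF smooth_inv_total]
    by (simp add: o_def)
  from this[of "\<lambda>p. fst (snd p)"] this[of "\<lambda>p. snd (snd p)"]
  have cont: "continuous_map ?Y (prod_topology (mtop (total_mfd E)) (mtop (total_mfd E)))
     (\<lambda>p. (s (inv_into W \<phi> (fst p), fst (snd p)), s (inv_into W \<phi> (fst p), snd (snd p))))"
    by (intro continuous_map_pairedI) (simp_all add: continuous_on_fst continuous_on_snd continuous_on_id)
  have eq: "square_inv = (\<lambda>p. (s (inv_into W \<phi> (fst p), fst (snd p)), s (inv_into W \<phi> (fst p), snd (snd p))))"
    by (simp add: fun_eq_iff)
  show ?thesis
    unfolding mtop_fibre_square eq
    by (rule continuous_map_into_subtopology[OF cont]) (auto simp: bproj_inv inv_W)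
qed

text \<open>Both entries of \<open>square_inv\<close> apply \<open>s\<close> over the same base
  point, so the inverse lands in the fibre square. The domain is open as a preimage of
  \<open>U \<inter> W\<close> under the bundle projection.\<close>

lemma is_chart_fibre_square: "is_chart (mtop (fibre_square E)) (square_dom E (U \<inter> W)) (square_map E \<phi> t)"
proof (rule is_chartI[where V = "\<phi> ` (U \<inter> W) \<times> UNIV" and g = square_inv])
  have "continuous_map (mtop (fibre_square E)) (mtop (base_mfd E)) (bproj E \<circ> fst)"
    unfolding mtop_fibre_square
    by (intro continuous_map_from_subtopology continuous_map_compose[OF continuous_map_fst]
      smooth_map_continuous smooth_bproj[OF vb])
  from openin_preimage_points[OF this open_UW]
  have "openin (mtop (fibre_square E)) (points (fibre_square E) \<inter> (bproj E \<circ> fst) -` (U \<inter> W))" .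
  also have "points (fibre_square E) \<inter> (bproj E \<circ> fst) -` (U \<inter> W) = square_dom E (U \<inter> W)"
    by (auto simp: points_fibre_square square_dom_iff)
  finally show "openin (mtop (fibre_square E)) (square_dom E (U \<inter> W))" .
  show "open (\<phi> ` (U \<inter> W) \<times> (UNIV :: ('f \<times> 'f) set))"
    using is_chart_open_image[OF chart_W open_UW] by (auto intro: open_Times)
qed (fact continuous_triv_square continuous_square_inv square_map_in square_map_inv square_inv_map)+

text \<open>Meant for the two projections, with \<open>l\<close> equal to \<open>fst\<close> or
  \<open>snd\<close>. Since \<open>h\<close> preserves the base point and acts on fibre coordinates
  by \<open>l\<close>, its chart expression is that of \<open>s\<close> preceded by the bounded
  linear map (x, y, z) to (x, l (y, z)). Smoothness of \<open>s\<close> thus links the charts of the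
  square to those of the total space.\<close>

lemma smooth_in_charts_fibre_square:
  assumes V: "(V, \<psi>) \<in> charts (total_mfd E)"
    and h: "\<And>p. p \<in> square_dom E (U \<inter> W) \<Longrightarrow> h p \<in> fibre E (bproj E (fst p))"
    and l: "bounded_linear l" and l_h: "\<And>p. p \<in> square_dom E (U \<inter> W) \<Longrightarrow> t (h p) = l (t (fst p), t (snd p))"
    and cont: "continuous_map (mtop (fibre_square E)) (mtop (total_mfd E)) h"
  shows "smooth_on (square_map E \<phi> t ` (square_dom E (U \<inter> W) \<inter> h -` V))
     (\<psi> \<circ> h \<circ> inv_into (square_dom E (U \<inter> W)) (square_map E \<phi> t))"
proof -
  let ?D = "square_dom E (U \<inter> W)" and ?\<kappa> = "square_map E \<phi> t"
  let ?A = "?\<kappa> ` (?D \<inter> h -` V)" and ?C = "(W \<inter> U) \<times> (UNIV :: 'f set)"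
  note cV = charted_is_chart[OF charted(2) V]
  have oV: "openin (mtop (total_mfd E)) V" using cV by (simp add: is_chart_def)
  \<comment> \<open>This is the chart of the source of \<open>s\<close> that matches the chart of
    the square: the base chart cut down to \<open>U\<close>, and the identity on the typical
    fibre.\<close>
  have "(?C, map_prod \<phi> id) \<in> charts (prod_manifold (open_submanifold (base_mfd E) U) (euclidean_manifold :: ('f, 'f) manifold))"
    using W unfolding prod_manifold_def open_submanifold_def euclidean_manifold_def by auto
  note C = this charted_is_chart[OF charted_prod[OF charted_base_U charted(3)] this]
  have oA: "open ?A"
    by (rule open_chart_image_preimage[OF is_chart_fibre_square cont oV])
  have oB: "open (map_prod \<phi> id ` (?C \<inter> s -` V))"
    by (rule open_chart_image_preimage[OF C(2) smooth_map_continuous[OF smooth_inv_total] oV])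
  have fd: "finite_dim TYPE('m \<times> 'f)"
    using charted(1) finite_dim_fibre[OF vb] by (simp add: charted_def finite_dim_prod)
  have hs: "h (v, w) = s (bproj E v, l (t v, t w))" if "(v, w) \<in> ?D" for v w
    using inv_triv_fibre[OF _ h[OF that]] l_h[OF that] that by (auto simp: square_dom_iff)
  have inv: "inv_into ?C (map_prod \<phi> id) (\<phi> x, y) = (x, y)" if "x \<in> U" "x \<in> W" for x and y :: 'f
    using is_chart_inj[OF C(2)] that by (intro inv_into_f_eq) auto
  have inv': "inv_into ?D ?\<kappa> (?\<kappa> p) = p" if "p \<in> ?D" for p
    using is_chart_inj[OF is_chart_fibre_square] that by simp
  have "smooth_on ?A (\<lambda>p. (\<psi> \<circ> s \<circ> inv_into ?C (map_prod \<phi> id)) (fst p, l (snd p)))"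
  proof (rule smooth_on_compose[OF fd oA oB _ smooth_map_in_charts[OF smooth_inv_total C(1) V]])
    show "smooth_on ?A (\<lambda>p. (fst p, l (snd p)))"
      by (intro smooth_on_Pair oA smooth_on_bounded_linear bounded_linear_fst
          bounded_linear_compose[OF l bounded_linear_snd])
    show "(fst p, l (snd p)) \<in> map_prod \<phi> id ` (?C \<inter> s -` V)" if "p \<in> ?A" for p
    proof -
      obtain v w where vw: "(v, w) \<in> ?D" "h (v, w) \<in> V" "p = ?\<kappa> (v, w)" using \<open>p \<in> ?A\<close> by auto
      then show ?thesis
        using hs[OF vw(1)]
        by (intro image_eqI[of _ _ "(bproj E v, l (t v, t w))"]) (auto simp: square_map_def square_dom_iff)
    qed
  qed
  then show ?thesis
    by (rule smooth_on_cong[OF oA, rotated]) (auto simp: inv' hs, auto simp: square_map_def square_dom_iff inv)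
qed

end

end

context
  fixes E :: "('p, 'm::real_inner, 'e, 'k::real_inner, 'f::real_inner) vbundle"
  assumes vb: "vector_bundle E"
begin

lemma charted_fibre_square: "charted (fibre_square E)"
proof -
  have c: "is_chart (mtop (fibre_square E)) A \<kappa>" if A: "(A, \<kappa>) \<in> charts (fibre_square E)" for A \<kappa>
  proof -
    obtain U t W \<phi> where *: "(U, t) \<in> trivs E" "(W, \<phi>) \<in> charts (base_mfd E)"
      "A = square_dom E (U \<inter> W)" "\<kappa> = square_map E \<phi> t"
      using A by (auto simp: charts_fibre_square)
    from trivialized_exists[OF vb *(1)] obtain s where "trivialized E U t s" ..
    from trivialized.is_chart_fibre_square[OF this *(2)] show ?thesis by (simp add: *)
  qed
  have "\<exists>c\<in>charts (fibre_square E). p \<in> fst c" if p: "p \<in> points (fibre_square E)" for p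
  proof -
    obtain v w where vw: "p = (v, w)" "v \<in> vectors E" "w \<in> vectors E" "bproj E v = bproj E w"
      using p by (auto simp: points_fibre_square)
    note b = bproj_in_base[OF vb vw(2)]
    obtain U t where "(U, t) \<in> trivs E" "bproj E v \<in> U" using vb b unfolding vector_bundle_def by blast
    moreover obtain W \<phi> where "(W, \<phi>) \<in> charts (base_mfd E)" "bproj E v \<in> W"
      using charted_chart_at[OF charted_base[OF vb] b] by blast
    ultimately show ?thesis
      using vw by (intro bexI[of _ "(square_dom E (U \<inter> W), square_map E \<phi> t)"])
        (auto simp: charts_fibre_square square_dom_iff)
  qed
  moreover have "finite_dim TYPE('m \<times> 'f \<times> 'f)"
    using charted_base[OF vb] finite_dim_fibre[OF vb] by (simp add: charted_def finite_dim_prod)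
  moreover have "A \<subseteq> points (fibre_square E)" if "(A, \<kappa>) \<in> charts (fibre_square E)" for A \<kappa>
    using is_chart_subset[OF c[OF that]] .
  moreover have "(\<Union>(A, \<kappa>)\<in>charts (fibre_square E). A) = points (fibre_square E)"
  proof
    show "(\<Union>(A, \<kappa>)\<in>charts (fibre_square E). A) \<subseteq> points (fibre_square E)"
      using calculation(3) by blast
    show "points (fibre_square E) \<subseteq> (\<Union>(A, \<kappa>)\<in>charts (fibre_square E). A)"
    proof
      fix p assume "p \<in> points (fibre_square E)"
      from calculation(1)[OF this] obtain c where "c \<in> charts (fibre_square E)" "p \<in> fst c" ..
      then show "p \<in> (\<Union>(A, \<kappa>)\<in>charts (fibre_square E). A)" by (cases c) auto
    qed
  qed
  ultimately show ?thesis
    unfolding charted_def using c by blast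
qed

lemma smooth_fst_snd_fibre_square:
  "smooth_map (fibre_square E) (total_mfd E) fst" "smooth_map (fibre_square E) (total_mfd E) snd"
proof -
  have cont: "continuous_map (mtop (fibre_square E)) (mtop (total_mfd E)) fst"
     "continuous_map (mtop (fibre_square E)) (mtop (total_mfd E)) snd"
    unfolding mtop_fibre_square
    by (intro continuous_map_from_subtopology continuous_map_fst continuous_map_snd)+
  have "smooth_on (\<kappa> ` (D \<inter> fst -` V)) (\<psi> \<circ> fst \<circ> inv_into D \<kappa>) \<and>
      smooth_on (\<kappa> ` (D \<inter> snd -` V)) (\<psi> \<circ> snd \<circ> inv_into D \<kappa>)"
    if D: "(D, \<kappa>) \<in> charts (fibre_square E)" and V: "(V, \<psi>) \<in> charts (total_mfd E)" for D \<kappa> V \<psi>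
  proof -
    obtain U t W \<phi> where *: "(U, t) \<in> trivs E" "(W, \<phi>) \<in> charts (base_mfd E)"
      "D = square_dom E (U \<inter> W)" "\<kappa> = square_map E \<phi> t"
      using D by (auto simp: charts_fibre_square)
    from trivialized_exists[OF vb *(1)] obtain s where tr: "trivialized E U t s" ..
    show ?thesis
      unfolding *(3,4)
      by (intro conjI trivialized.smooth_in_charts_fibre_square[OF tr *(2) V, where l = fst]
         trivialized.smooth_in_charts_fibre_square[OF tr *(2) V, where l = snd] cont
         bounded_linear_fst bounded_linear_snd)
       (auto simp: square_dom_iff fibre_def)
  qed
  then show "smooth_map (fibre_square E) (total_mfd E) fst" "smooth_map (fibre_square E) (total_mfd E) snd"
    using cont unfolding smooth_map_def by blast+
qed

text \<open>Operations are smooth on the fibre square, so this is what makes the squaring map v to m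
  (v, v) smooth on the total space.\<close>

lemma smooth_diagonal: "smooth_map (total_mfd E) (fibre_square E) (\<lambda>v. (v, v))"
proof -
  have cont: "continuous_map (mtop (total_mfd E)) (mtop (fibre_square E)) (\<lambda>v. (v, v))"
    unfolding mtop_fibre_square
    by (intro continuous_map_into_subtopology continuous_map_pairedI) auto
  have "smooth_on (\<psi> ` (V \<inter> (\<lambda>v. (v, v)) -` D)) (\<kappa> \<circ> (\<lambda>v. (v, v)) \<circ> inv_into V \<psi>)"
    if D: "(D, \<kappa>) \<in> charts (fibre_square E)" and V: "(V, \<psi>) \<in> charts (total_mfd E)" for D \<kappa> V \<psi>
  proof -
    obtain U t W \<phi> where *: "(U, t) \<in> trivs E" "(W, \<phi>) \<in> charts (base_mfd E)"
      "D = square_dom E (U \<inter> W)" "\<kappa> = square_map E \<phi> t"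
      using D by (auto simp: charts_fibre_square)
    from trivialized_exists[OF vb *(1)] obtain s where tr: "trivialized E U t s" ..
    note cV = charted_is_chart[OF charted_total[OF vb] V]
    have oA: "open (\<psi> ` (V \<inter> (\<lambda>v. (v, v)) -` D))" (is "open ?A")
      by (rule open_chart_image_preimage[OF cV cont])
       (use charted_is_chart[OF charted_fibre_square D] in \<open>simp add: is_chart_def\<close>)
    have inv: "inv_into V \<psi> (\<psi> v) = v" if "v \<in> V" for v
      using is_chart_inj[OF cV] that by simp
    have U: "(V \<inter> bproj E -` U, \<psi>) \<in> charts (open_submanifold (total_mfd E) (bproj E -` U))"
      using V by (auto simp: open_submanifold_def)
    have "(UNIV, id) \<in> charts (euclidean_manifold :: ('f, 'f) manifold)"
      by (simp add: euclidean_manifold_def)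
    from smooth_map_in_charts[OF trivialized.smooth_t[OF tr] U this]
    have "smooth_on ?A (id \<circ> t \<circ> inv_into (V \<inter> bproj E -` U) \<psi>)"
      by (rule smooth_on_subset) (auto simp: * square_dom_iff)
    then have t: "smooth_on ?A (t \<circ> inv_into V \<psi>)"
      by (rule smooth_on_cong[OF oA, rotated])
        (use is_chart_inj[OF cV] in \<open>auto simp: inj_on_Int * square_dom_iff\<close>)
    have b: "smooth_on ?A (\<phi> \<circ> bproj E \<circ> inv_into V \<psi>)"
      by (rule smooth_on_subset[OF smooth_map_in_charts[OF smooth_bproj[OF vb] V *(2)]])
        (auto simp: * square_dom_iff)
    show ?thesis
      using smooth_on_Pair[OF oA b smooth_on_Pair[OF oA t t]] by (simp add: * square_map_def o_def)
  qed
  then show ?thesis using cont unfolding smooth_map_def by blast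
qed

end

section \<open>Homogeneous maps and the algebra of the operation\<close>

text \<open>Along the ray through \<open>x\<close> the map c to f (c x) has derivative c to D (c x)
  at 0, where D is the derivative of \<open>f\<close> at 0. By homogeneity it is also the linear map
  c to c f x. Evaluation at c = 1 gives f = D.\<close>

lemma homogeneous_imp_linear:
  fixes f :: "'a::real_normed_vector \<Rightarrow> 'b::real_normed_vector"
  assumes d: "f differentiable (at 0)" and hom: "\<And>c x. f (c *\<^sub>R x) = c *\<^sub>R f x"
  shows "linear f"
proof -
  obtain D where D: "(f has_derivative D) (at 0)" using d unfolding differentiable_def by blast
  have "D x = f x" for x
  proof -
    have "((\<lambda>c. f (c *\<^sub>R x)) has_derivative (\<lambda>c. D (c *\<^sub>R x))) (at 0)"
      by (rule has_derivative_compose[where g = f]) (use D in \<open>auto intro!: derivative_eq_intros\<close>)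
    moreover have "((\<lambda>c. f (c *\<^sub>R x)) has_derivative (\<lambda>c. c *\<^sub>R f x)) (at 0)"
      unfolding hom by (auto intro!: derivative_eq_intros)
    ultimately have "(\<lambda>c. D (c *\<^sub>R x)) = (\<lambda>c. c *\<^sub>R f x)" by (rule has_derivative_unique)
    from fun_cong[OF this, of 1] show ?thesis by simp
  qed
  then have "D = f" by blast
  with has_derivative_linear[OF D] show ?thesis by simp
qed

text \<open>Differentiating the homogeneity along rays gives Euler's identity, so Q y is half the
  derivative at y applied to y. Differentiating it in y shows that the derivative in a fixed
  direction is homogeneous of degree 1 in the base point, hence linear there by the degree 1 case.
  The derivative of \<open>Q\<close> is therefore bilinear in base point and direction.\<close>

lemma homogeneous_2_imp_bilinear_polarization:
  fixes Q :: "'a::real_normed_vector \<Rightarrow> 'b::real_normed_vector"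
  assumes Q: "smooth_on UNIV Q" and hom: "\<And>c x. Q (c *\<^sub>R x) = c\<^sup>2 *\<^sub>R Q x"
  shows "bilinear (\<lambda>x y. (1/2) *\<^sub>R (Q (x + y) - Q x - Q y))"
proof -
  let ?D = "\<lambda>y. frechet_derivative Q (at y)"
  have D: "(Q has_derivative ?D y) (at y)" for y
    using smooth_on_differentiable[OF Q] frechet_derivative_works by blast
  have lin2: "linear (?D y)" for y by (rule has_derivative_linear[OF D])
  have line: "((\<lambda>c. Q (c *\<^sub>R y)) has_derivative (\<lambda>c. ?D (r *\<^sub>R y) (c *\<^sub>R y))) (at r)" for r y
    by (rule has_derivative_compose[where g = Q]) (use D in \<open>auto intro!: derivative_eq_intros\<close>)
  have line': "((\<lambda>c. Q (c *\<^sub>R y)) has_derivative (\<lambda>c. (2 * r * c) *\<^sub>R Q y)) (at r)" for r y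
    unfolding hom by (auto intro!: derivative_eq_intros)
  have euler: "?D (r *\<^sub>R y) y = (2 * r) *\<^sub>R Q y" for r y
    using fun_cong[OF has_derivative_unique[OF line line'], of r y 1] by simp
  have D_hom: "?D (c *\<^sub>R y) h = c *\<^sub>R ?D y h" for c y h
  proof (cases "c = 0")
    \<comment> \<open>Here \<open>c\<close> cannot be cancelled as in the other case, but Euler's
      identity at r = 0 says that the derivative at 0 annihilates \<open>h\<close>.\<close>
    case True
    then show ?thesis using euler[of 0 h] by simp
  next
    case False
    have "((\<lambda>y. Q (c *\<^sub>R y)) has_derivative (\<lambda>h. ?D (c *\<^sub>R y) (c *\<^sub>R h))) (at y)"
      by (rule has_derivative_compose[where g = Q]) (use D in \<open>auto intro!: derivative_eq_intros\<close>)
    moreover have "((\<lambda>y. Q (c *\<^sub>R y)) has_derivative (\<lambda>h. c\<^sup>2 *\<^sub>R ?D y h)) (at y)"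
      unfolding hom by (intro has_derivative_scaleR_right D)
    ultimately have "?D (c *\<^sub>R y) (c *\<^sub>R h) = c\<^sup>2 *\<^sub>R ?D y h"
      by (rule has_derivative_unique[THEN fun_cong])
    then have "c *\<^sub>R ?D (c *\<^sub>R y) h = c *\<^sub>R (c *\<^sub>R ?D y h)"
      by (simp add: linear_cmul[OF lin2] power2_eq_square)
    then show ?thesis by (rule scaleR_left_imp_eq[OF False])
  qed
  have lin1: "linear (\<lambda>y. ?D y h)" for h
    by (rule homogeneous_imp_linear[OF smooth_on_differentiable[OF smooth_on_frechet_derivative[OF Q]] D_hom])
      simp
  have Q_eq: "Q y = (1/2) *\<^sub>R ?D y y" for y
    using euler[of 1 y] by simp
  \<comment> \<open>One factor 1/2 is that of the polarization, the other comes from Euler's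
    identity; the diagonal terms of the bilinear expansion cancel.\<close>
  have "(1/2) *\<^sub>R (Q (x + y) - Q x - Q y) = (1/4) *\<^sub>R (?D x y + ?D y x)" for x y
    unfolding Q_eq[of "x + y"] Q_eq[of x] Q_eq[of y]
    by (simp add: linear_add[OF lin1] linear_add[OF lin2] scaleR_add_right scaleR_diff_right)
  moreover have "bilinear (\<lambda>x y. (1/4) *\<^sub>R (?D x y + ?D y x))"
    unfolding bilinear_def
    by (intro conjI allI linearI)
      (simp_all add: linear_add[OF lin1] linear_add[OF lin2] linear_cmul[OF lin1] linear_cmul[OF lin2]
        scaleR_add_right)
  ultimately show ?thesis by presburger
qed

text \<open>With w = B v v the hypothesis gives B v w = 0 and B w (B w w) = 0. The identity at v + w
  then reduces to B v (B w w) + B w w = 0, and at w - v to B w w - B v (B w w) = 0. The mixed term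
  cancels in the sum, leaving twice B w w.\<close>

lemma bilinear_square_product_zero:
  assumes B: "bilinear B" and sym: "\<And>x y. B x y = B y x" and cubic: "\<And>v. B v (B v v) = 0"
  shows "B (B v v) (B v v) = 0"
proof -
  let ?w = "B v v"
  note simps = bilinear_ladd[OF B] bilinear_radd[OF B] bilinear_lsub[OF B] bilinear_rsub[OF B]
  have 1: "B v (B ?w ?w) + B ?w ?w = 0"
    using cubic[of "v + ?w"] cubic[of v] cubic[of ?w] sym[of ?w v]
    by (simp add: simps bilinear_rzero[OF B] add.commute)
  have 2: "B ?w ?w - B v (B ?w ?w) = 0"
    using cubic[of "?w - v"] cubic[of v] cubic[of ?w] sym[of ?w v]
    by (simp add: simps bilinear_rzero[OF B])
  have "B ?w ?w + B ?w ?w = (B v (B ?w ?w) + B ?w ?w) + (B ?w ?w - B v (B ?w ?w))"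
    by simp
  then have "B ?w ?w + B ?w ?w = 0"
    unfolding 1 2 by simp
  then show ?thesis by (simp flip: scaleR_2)
qed

section \<open>Fibres in coordinates\<close>

context trivialized
begin

lemma vspace_at: "x \<in> U \<Longrightarrow> real_vector_space_ops (fibre E x) (vzero E x) (vadd E) (vscale E)"
  using vspace[OF vb] U_subset by blast

lemma fibre_closed:
  assumes "x \<in> U"
  shows "vzero E x \<in> fibre E x" "v \<in> fibre E x \<Longrightarrow> w \<in> fibre E x \<Longrightarrow> vadd E v w \<in> fibre E x"
    "v \<in> fibre E x \<Longrightarrow> vscale E a v \<in> fibre E x"
proof -
  have "vzero E x \<in> fibre E x \<and> (\<forall>v\<in>fibre E x. \<forall>w\<in>fibre E x. vadd E v w \<in> fibre E x) \<and>
      (\<forall>a. \<forall>v\<in>fibre E x. vscale E a v \<in> fibre E x)"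
    using vspace_at[OF assms] unfolding real_vector_space_ops_def by (elim conjE) (intro conjI; assumption)
  then show "vzero E x \<in> fibre E x" "v \<in> fibre E x \<Longrightarrow> w \<in> fibre E x \<Longrightarrow> vadd E v w \<in> fibre E x"
    "v \<in> fibre E x \<Longrightarrow> vscale E a v \<in> fibre E x" by blast+
qed

text \<open>A trivialization is only assumed additive and homogeneous on fibres; the zero vector is
  caught through 0 + 0 = 0.\<close>

lemma triv_zero:
  assumes "x \<in> U"
  shows "t (vzero E x) = 0"
proof -
  have z: "vzero E x \<in> fibre E x" using fibre_closed[OF assms] by blast
  then have "vadd E (vzero E x) (vzero E x) = vzero E x"
    using vspace_at[OF assms] unfolding real_vector_space_ops_def by blast
  with triv_add[OF assms z z] show ?thesis by simp
qed

lemma inv_add: "x \<in> U \<Longrightarrow> s (x, y + z) = vadd E (s (x, y)) (s (x, z))"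
  by (rule triv_eqI[of x]) (simp_all add: inv_in_fibre fibre_closed triv_add[of x] triv_inv)

lemma inv_scale: "x \<in> U \<Longrightarrow> s (x, a *\<^sub>R y) = vscale E a (s (x, y))"
  by (rule triv_eqI[of x]) (simp_all add: inv_in_fibre fibre_closed triv_scale[of x] triv_inv)

text \<open>The operation transported to the type of the typical fibre, where the library notion
  \<open>bilinear\<close> and the algebra of vector spaces apply.\<close>

definition coord_op :: "('e \<times> 'e \<Rightarrow> 'e) \<Rightarrow> 'p \<Rightarrow> 'f \<Rightarrow> 'f \<Rightarrow> 'f" where
  "coord_op m x y z = t (m (s (x, y), s (x, z)))"

lemma triv_op: "x \<in> U \<Longrightarrow> v \<in> fibre E x \<Longrightarrow> w \<in> fibre E x \<Longrightarrow> t (m (v, w)) = coord_op m x (t v) (t w)"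
  by (simp add: coord_op_def inv_triv_fibre)

end

section \<open>Smooth maps into the total space\<close>

context
  fixes E :: "('p, 'm::real_inner, 'e, 'k::real_inner, 'f::real_inner) vbundle"
  assumes vb: "vector_bundle E"
begin

lemma fibre_trivialized:
  assumes "v \<in> vectors E"
  obtains U t s where "trivialized E U t s" "bproj E v \<in> U" "v \<in> fibre E (bproj E v)"
  using trivialized_at[OF vb bproj_in_base[OF vb assms]] assms unfolding fibre_def by blast

text \<open>Over a trivializing set f x = s (p x, t (f x)). Once the base component \<open>p\<close>
  is smooth, only the fibre coordinate remains to be checked, and there the fibrewise operations
  become linear algebra.\<close>

lemma smooth_map_total_via_trivializations:
  assumes N: "charted N" and p: "smooth_map N (base_mfd E) p"
    and f: "\<And>x. x \<in> points N \<Longrightarrow> f x \<in> fibre E (p x)"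
    and tf: "\<And>U t s. trivialized E U t s \<Longrightarrow> openin (mtop N) (points N \<inter> p -` U) \<Longrightarrow>
      smooth_map (open_submanifold N (p -` U)) euclidean_manifold (\<lambda>x. t (f x))"
  shows "smooth_map N (total_mfd E) f"
proof (rule smooth_map_local[OF N charted_total[OF vb]])
  fix x assume x: "x \<in> points N"
  then obtain U t s where tr: "trivialized E U t s" and xU: "p x \<in> U"
    using trivialized_at[OF vb smooth_map_in_points[OF p x]] by blast
  interpret trivialized E U t s by (rule tr)
  have o: "openin (mtop N) (points N \<inter> p -` U)"
    by (rule openin_preimage_points[OF smooth_map_continuous[OF p] open_U])
  note N' = charted_open_submanifold[OF N o]
  have "smooth_map (open_submanifold N (p -` U)) (total_mfd E) (\<lambda>x. s (p x, t (f x)))"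
    by (rule smooth_map_inv[OF N' smooth_map_restrict[OF N charted(1) o p] _ tf[OF tr o]]) simp
  then have "smooth_map (open_submanifold N (p -` U)) (total_mfd E) f"
    by (rule smooth_map_cong[OF N' charted(2)]) (use f in \<open>auto simp: inv_triv_fibre\<close>)
  then show "\<exists>W. openin (mtop N) (points N \<inter> W) \<and> x \<in> W \<and> smooth_map (open_submanifold N W) (total_mfd E) f"
    using o xU by blast
qed

lemma smooth_bproj_fst: "smooth_map (fibre_square E) (base_mfd E) (\<lambda>p. bproj E (fst p))"
  by (rule smooth_map_compose[OF charted_fibre_square[OF vb] charted_total[OF vb] charted_base[OF vb]
     smooth_fst_snd_fibre_square(1)[OF vb] smooth_bproj[OF vb]])

text \<open>Smoothness of addition is not part of the definition of a vector bundle; it follows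
  because addition becomes that of the typical fibre. It is used for the term q (v + w) of the
  polarization.\<close>

lemma smooth_vadd: "smooth_map (fibre_square E) (total_mfd E) (\<lambda>(v, w). vadd E v w)"
proof (rule smooth_map_total_via_trivializations[OF charted_fibre_square[OF vb] smooth_bproj_fst])
  show "(case p of (v, w) \<Rightarrow> vadd E v w) \<in> fibre E (bproj E (fst p))" if "p \<in> points (fibre_square E)" for p
    using that vspace[OF vb bproj_in_base[OF vb, of "fst p"]]
    unfolding real_vector_space_ops_def points_fibre_square by (auto simp: fibre_def)
  fix U t s
  assume tr: "trivialized E U t s" and o: "openin (mtop (fibre_square E)) (points (fibre_square E) \<inter> (\<lambda>p. bproj E (fst p)) -` U)"
  interpret trivialized E U t s by (rule tr)
  let ?N = "open_submanifold (fibre_square E) ((\<lambda>p. bproj E (fst p)) -` U)"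
  note N = charted_open_submanifold[OF charted_fibre_square[OF vb] o]
  note r = smooth_map_restrict[OF charted_fibre_square[OF vb] charted(2) o]
  have "smooth_map ?N euclidean_manifold (\<lambda>p. t (fst p) + t (snd p))"
    by (intro smooth_map_add[OF N finite_dim_fibre[OF vb]] smooth_map_triv[OF N] r smooth_fst_snd_fibre_square[OF vb])
      (auto simp: points_fibre_square)
  then show "smooth_map ?N euclidean_manifold (\<lambda>p. t (case p of (v, w) \<Rightarrow> vadd E v w))"
    by (rule smooth_map_cong[OF N charted(3)])
      (auto simp: points_fibre_square fibre_def intro!: triv_add[symmetric])
qed

end

section \<open>From operations to actions\<close>

text \<open>Written exactly as the map in the theorem, so that the latter can be folded into it; the
  restriction makes the result extensional.\<close>

definition jet2_act :: "('p, 'm::real_inner, 'e, 'k::real_inner, 'f::real_inner) vbundle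
     \<Rightarrow> ('e \<times> 'e \<Rightarrow> 'e) \<Rightarrow> jet2 \<times> 'e \<Rightarrow> 'e" where
  "jet2_act E m = (\<lambda>((a, b), v)\<in>UNIV \<times> vectors E. vadd E (vscale E a v) (vscale E b (m (v, v))))"

lemma jet2_act_apply:
  "v \<in> vectors E \<Longrightarrow> jet2_act E m ((a, b), v) = vadd E (vscale E a v) (vscale E b (m (v, v)))"
  by (simp add: jet2_act_def)

lemma bilinear_operation_smooth:
  assumes "bilinear_operation E m"
  shows "smooth_map (fibre_square E) (total_mfd E) m"
  using conjunct1[OF conjunct2[OF assms[unfolded bilinear_operation_def]]] .

lemma bilinear_operation_fibrewise:
  assumes "bilinear_operation E m" "x \<in> points (base_mfd E)"
  shows bilinear_operation_in_fibre: "\<lbrakk>v \<in> fibre E x; w \<in> fibre E x\<rbrakk> \<Longrightarrow> m (v, w) \<in> fibre E x"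
    and bilinear_operation_add: "\<lbrakk>u \<in> fibre E x; v \<in> fibre E x; w \<in> fibre E x\<rbrakk> \<Longrightarrow>
      m (vadd E u v, w) = vadd E (m (u, w)) (m (v, w)) \<and> m (u, vadd E v w) = vadd E (m (u, v)) (m (u, w))"
    and bilinear_operation_scale: "\<lbrakk>v \<in> fibre E x; w \<in> fibre E x\<rbrakk> \<Longrightarrow>
      m (vscale E a v, w) = vscale E a (m (v, w)) \<and> m (v, vscale E a w) = vscale E a (m (v, w))"
proof -
  note * = bspec[OF conjunct2[OF conjunct2[OF assms(1)[unfolded bilinear_operation_def]]] assms(2)]
  show "\<lbrakk>v \<in> fibre E x; w \<in> fibre E x\<rbrakk> \<Longrightarrow> m (v, w) \<in> fibre E x"
    by (rule bspec[OF bspec[OF conjunct1[OF *]]])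
  show "\<lbrakk>u \<in> fibre E x; v \<in> fibre E x; w \<in> fibre E x\<rbrakk> \<Longrightarrow>
      m (vadd E u v, w) = vadd E (m (u, w)) (m (v, w)) \<and> m (u, vadd E v w) = vadd E (m (u, v)) (m (u, w))"
    by (rule bspec[OF bspec[OF bspec[OF conjunct1[OF conjunct2[OF *]]]]])
  show "\<lbrakk>v \<in> fibre E x; w \<in> fibre E x\<rbrakk> \<Longrightarrow>
      m (vscale E a v, w) = vscale E a (m (v, w)) \<and> m (v, vscale E a w) = vscale E a (m (v, w))"
    by (rule bspec[OF bspec[OF spec[OF conjunct2[OF conjunct2[OF *]]]]])
qed

context trivialized
begin

lemma op_in_fibre:
  "bilinear_operation E m \<Longrightarrow> x \<in> U \<Longrightarrow> v \<in> fibre E x \<Longrightarrow> w \<in> fibre E x \<Longrightarrow> m (v, w) \<in> fibre E x"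
  by (rule bilinear_operation_in_fibre[OF _ subsetD[OF U_subset]])

lemma bilinear_coord_op:
  assumes m: "bilinear_operation E m" and x: "x \<in> U"
  shows "bilinear (coord_op m x)"
proof -
  have xB: "x \<in> points (base_mfd E)" using x U_subset by blast
  show ?thesis
    unfolding bilinear_def coord_op_def
    by (intro conjI allI linearI)
      (simp_all add: x inv_add inv_scale inv_in_fibre triv_add[OF x] triv_scale[OF x] op_in_fibre[OF m x]
         bilinear_operation_add[OF m xB] bilinear_operation_scale[OF m xB])
qed

lemma coord_op_sym:
  assumes m: "symmetric_operation E m" and x: "x \<in> U"
  shows "coord_op m x y z = coord_op m x z y"
  using m x inv_in_vectors bproj_inv unfolding symmetric_operation_def coord_op_def points_fibre_square
  by fastforce

lemma act_in_fibre:
  assumes m: "bilinear_operation E m" and x: "x \<in> U" and v: "v \<in> fibre E x"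
  shows "jet2_act E m (g, v) \<in> fibre E x"
proof -
  obtain a b where "g = (a, b)" by (cases g)
  moreover have "v \<in> vectors E" using v by (simp add: fibre_def)
  ultimately show ?thesis
    using v by (simp add: jet2_act_apply fibre_closed[OF x] op_in_fibre[OF m x])
qed

lemma triv_act:
  assumes m: "bilinear_operation E m" and x: "x \<in> U" and v: "v \<in> fibre E x"
  shows "t (jet2_act E m ((a, b), v)) = a *\<^sub>R t v + b *\<^sub>R coord_op m x (t v) (t v)"
proof -
  have "v \<in> vectors E" using v by (simp add: fibre_def)
  then show ?thesis
    using v by (simp add: jet2_act_apply triv_add[OF x] triv_scale[OF x] fibre_closed[OF x] op_in_fibre[OF m x] triv_op[OF x])
qed

end

context
  fixes E :: "('p, 'm::real_inner, 'e, 'k::real_inner, 'f::real_inner) vbundle" and m :: "'e \<times> 'e \<Rightarrow> 'e"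
  assumes vb: "vector_bundle E" and m: "bilinear_operation E m"
begin

text \<open>In a trivialization the fibre coordinate is a t v + b t (m (v, v)), a combination of
  smooth functions on the product of jets and vectors.\<close>

lemma smooth_jet2_act:
  "smooth_map (prod_manifold euclidean_manifold (total_mfd E)) (total_mfd E) (jet2_act E m)"
proof -
  let ?P = "prod_manifold (euclidean_manifold :: (jet2, jet2) manifold) (total_mfd E)"
  note T = charted_total[OF vb]
  have fdJ: "finite_dim TYPE(jet2)" by (intro finite_dim_prod finite_dim_real)
  note J = charted_euclidean[OF fdJ] and R = charted_euclidean[OF finite_dim_real]
  have P: "charted ?P" by (rule charted_prod[OF J T])
  have snd: "smooth_map ?P (total_mfd E) snd" by (rule smooth_map_snd[OF J T smooth_id_total[OF vb]])
  have "smooth_on UNIV (fst :: jet2 \<Rightarrow> real)" "smooth_on UNIV (snd :: jet2 \<Rightarrow> real)"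
    by (intro smooth_on_bounded_linear open_UNIV bounded_linear_fst bounded_linear_snd)+
  note c = this[folded smooth_map_euclidean_iff,
      THEN smooth_map_compose[OF P J R smooth_map_fst[OF J T smooth_id_euclidean]]]
  have mm: "smooth_map ?P (total_mfd E) (\<lambda>p. m (snd p, snd p))"
    by (rule smooth_map_compose[OF P charted_fibre_square[OF vb] T
          smooth_map_compose[OF P T charted_fibre_square[OF vb] snd smooth_diagonal[OF vb]]
          bilinear_operation_smooth[OF m]])
  show ?thesis
  proof (rule smooth_map_total_via_trivializations[OF vb P
      smooth_map_compose[OF P T charted_base[OF vb] snd smooth_bproj[OF vb]]])
    fix p assume "p \<in> points ?P"
    then have v: "snd p \<in> vectors E" by auto
    from fibre_trivialized[OF vb v] obtain U t s where "trivialized E U t s" "bproj E (snd p) \<in> U"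
      "snd p \<in> fibre E (bproj E (snd p))" .
    from trivialized.act_in_fibre[OF this(1) m this(2,3)]
    show "jet2_act E m p \<in> fibre E (bproj E (snd p))" by (metis prod.collapse)
  next
    fix U t s
    assume tr: "trivialized E U t s" and o: "openin (mtop ?P) (points ?P \<inter> (\<lambda>p. bproj E (snd p)) -` U)"
    interpret trivialized E U t s by (rule tr)
    let ?N = "open_submanifold ?P ((\<lambda>p. bproj E (snd p)) -` U)"
    note N = charted_open_submanifold[OF P o] and res = smooth_map_restrict[OF P _ o]
    have in_fibre: "m (v, v) \<in> fibre E (bproj E v)" if "v \<in> vectors E" for v
      using bilinear_operation_in_fibre[OF m bproj_in_base[OF vb that]] that by (simp add: fibre_def)
    have "smooth_map ?N euclidean_manifold
       (\<lambda>p. fst (fst p) *\<^sub>R t (snd p) + snd (fst p) *\<^sub>R t (m (snd p, snd p)))"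
      by (intro smooth_map_add[OF N finite_dim_fibre[OF vb]] smooth_map_scaleR[OF N finite_dim_fibre[OF vb]]
          smooth_map_triv[OF N] res c snd mm T R) (use in_fibre in \<open>auto simp: fibre_def\<close>)
    then show "smooth_map ?N euclidean_manifold (\<lambda>p. t (jet2_act E m p))"
    proof (rule smooth_map_cong[OF N charted(3)])
      fix p assume "p \<in> points ?N"
      then obtain a b v where p: "p = ((a, b), v)" "v \<in> vectors E" and x: "bproj E v \<in> U" by auto
      then have v: "v \<in> fibre E (bproj E v)" by (simp add: fibre_def)
      show "fst (fst p) *\<^sub>R t (snd p) + snd (fst p) *\<^sub>R t (m (snd p, snd p)) = t (jet2_act E m p)"
        by (simp add: p(1) triv_act[OF m x v] triv_op[OF x v v])
    qed
  qed
qed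

lemma jet2_act_action:
  assumes sym: "symmetric_operation E m"
    and cubic: "\<And>v. v \<in> vectors E \<Longrightarrow> m (v, m (v, v)) = vzero E (bproj E v)"
  shows "smooth_jet2_action E (jet2_act E m)" "v \<in> vectors E \<Longrightarrow> jet2_act E m ((a, 0), v) = vscale E a v"
proof -
  have "jet2_act E m (jet2_one, v) = v \<and> jet2_act E m ((a, 0), v) = vscale E a v \<and>
      jet2_act E m (g, jet2_act E m (h, v)) = jet2_act E m (jet2_mult g h, v)"
    if v: "v \<in> vectors E" for v g h a
  proof -
    from fibre_trivialized[OF vb v] obtain U t s where tr: "trivialized E U t s" and x: "bproj E v \<in> U"
      and vf: "v \<in> fibre E (bproj E v)" .
    interpret trivialized E U t s by (rule tr)
    let ?x = "bproj E v" and ?B = "coord_op m (bproj E v)"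
    note B = bilinear_coord_op[OF m x] and Bsym = coord_op_sym[OF sym x]
    \<comment> \<open>Every \<open>y\<close> in the typical fibre is the coordinate of the vector s
      (x, y), so the cubic identity holds on the whole coordinate space.\<close>
    have B3: "?B y (?B y y) = 0" for y
    proof -
      let ?w = "s (?x, y)"
      have w: "?w \<in> fibre E ?x" "?w \<in> vectors E" "bproj E ?w = ?x"
        using inv_in_fibre[OF x] inv_in_vectors[OF x] bproj_inv[OF x] by auto
      have "?B y (?B y y) = t (m (?w, m (?w, ?w)))"
        using w op_in_fibre[OF m x] by (simp add: triv_op[OF x] triv_inv[OF x])
      also have "\<dots> = 0" using cubic[OF w(2)] w(3) triv_zero[OF x] by simp
      finally show ?thesis .
    qed
    note B4 = bilinear_square_product_zero[OF B Bsym B3]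
    note act = triv_act[OF m x] and actf = act_in_fibre[OF m x]
    obtain a1 b1 a2 b2 where gh: "g = (a1, b1)" "h = (a2, b2)" by (cases g, cases h) blast
    have "jet2_act E m (jet2_one, v) = v"
      by (rule triv_eqI[OF x]) (simp_all add: vf actf act jet2_one_def)
    moreover have "jet2_act E m ((a, 0), v) = vscale E a v"
      by (rule triv_eqI[OF x]) (simp_all add: vf actf act fibre_closed[OF x] triv_scale[OF x])
    \<comment> \<open>With y = t v, the square of a2 y + b2 B y y is a2^2 B y y + 2 a2 b2 B y (B y
      y) + b2^2 B (B y y) (B y y). The last two terms vanish by \<open>B3\<close> and
      \<open>B4\<close>, and the total coefficient of B y y becomes a1 b2 + b1 a2^2, the second
      component of the product of jets.\<close>
    moreover have "jet2_act E m (g, jet2_act E m (h, v)) = jet2_act E m (jet2_mult g h, v)"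
      by (rule triv_eqI[OF x])
        (simp_all add: vf actf act gh jet2_mult_def bilinear_ladd[OF B] bilinear_radd[OF B]
          bilinear_lmul[OF B] bilinear_rmul[OF B] B3 B4 Bsym[of "?B (t v) (t v)" "t v"] algebra_simps power2_eq_square)
    ultimately show ?thesis by blast
  qed
  then show "smooth_jet2_action E (jet2_act E m)" "v \<in> vectors E \<Longrightarrow> jet2_act E m ((a, 0), v) = vscale E a v"
    using smooth_jet2_act unfolding smooth_jet2_action_def by (auto simp: jet2_act_def)
qed

end

section \<open>From actions to operations\<close>

text \<open>The bundle has no subtraction of its own, so q (v + w) - q v - q w is spelled with
  \<open>vscale E (-1)\<close>. The factor 1/2 makes the value on the diagonal equal to q v.\<close>

definition polar_op :: "('p, 'm::real_inner, 'e, 'k::real_inner, 'f::real_inner) vbundle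
     \<Rightarrow> (jet2 \<times> 'e \<Rightarrow> 'e) \<Rightarrow> 'e \<times> 'e \<Rightarrow> 'e" where
  "polar_op E act = (\<lambda>(v, w)\<in>points (fibre_square E). vscale E (1/2)
     (vadd E (act ((0, 1), vadd E v w)) (vscale E (-1) (vadd E (act ((0, 1), v)) (act ((0, 1), w))))))"


context
  fixes E :: "('p, 'm::real_inner, 'e, 'k::real_inner, 'f::real_inner) vbundle" and act :: "jet2 \<times> 'e \<Rightarrow> 'e"
  assumes vb: "vector_bundle E" and act: "smooth_jet2_action E act"
    and homothety: "\<And>a v. v \<in> vectors E \<Longrightarrow> act ((a, 0), v) = vscale E a v"
begin

lemma smooth_act: "smooth_map (prod_manifold euclidean_manifold (total_mfd E)) (total_mfd E) act"
  and act_act: "v \<in> vectors E \<Longrightarrow> act (g, act (h, v)) = act (jet2_mult g h, v)"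
  using act unfolding smooth_jet2_action_def by blast+

lemma act_in_vectors: "v \<in> vectors E \<Longrightarrow> act (g, v) \<in> vectors E"
  using smooth_map_in_points[OF smooth_act, of "(g, v)"] by simp

lemma vscale_in_fibre: "v \<in> vectors E \<Longrightarrow> vscale E a v \<in> fibre E (bproj E v)"
  using vspace[OF vb bproj_in_base[OF vb]] unfolding real_vector_space_ops_def fibre_def by fastforce

text \<open>\<open>(0, 0)\<close> is a left zero of the monoid, so \<open>g.v\<close> and \<open>v\<close> have the same image under \<open>0\<close>.\<close>

lemma act_in_fibre_bproj:
  assumes v: "v \<in> vectors E"
  shows "act (g, v) \<in> fibre E (bproj E v)"
proof -
  have "act ((0, 0), act (g, v)) = act ((0, 0), v)"
    by (cases g) (simp add: act_act[OF v] jet2_mult_def)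
  then have "vscale E 0 (act (g, v)) = vscale E 0 v"
    using homothety v act_in_vectors by simp
  then have "bproj E (act (g, v)) = bproj E v"
    using vscale_in_fibre[OF v, of 0] vscale_in_fibre[OF act_in_vectors[OF v], of 0 g]
    by (simp add: fibre_def)
  then show ?thesis using act_in_vectors[OF v] by (simp add: fibre_def)
qed

lemma act_preserves_fibre: "v \<in> fibre E x \<Longrightarrow> act (g, v) \<in> fibre E x"
  using act_in_fibre_bproj by (auto simp: fibre_def)

text \<open>Two special cases matter: a constant vector gives smooth dependence on the jet, a
  constant jet gives smoothness of q.\<close>

lemma smooth_act_compose:
  fixes g :: "'a \<Rightarrow> jet2"
  assumes N: "charted N" and g: "smooth_map N euclidean_manifold g" and f: "smooth_map N (total_mfd E) f"
  shows "smooth_map N (total_mfd E) (\<lambda>x. act (g x, f x))"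
proof -
  have J: "charted (euclidean_manifold :: (jet2, jet2) manifold)"
    by (intro charted_euclidean finite_dim_prod finite_dim_real)
  note T = charted_total[OF vb]
  show ?thesis
    by (rule smooth_map_compose[OF N charted_prod[OF J T] T smooth_map_Pair[OF N J T g f] smooth_act])
qed

lemma smooth_act_const:
  assumes N: "charted N" and f: "smooth_map N (total_mfd E) f"
  shows "smooth_map N (total_mfd E) (\<lambda>x. act (g, f x))"
  by (intro smooth_act_compose N f smooth_map_const charted_euclidean finite_dim_prod finite_dim_real) simp

section \<open>The map q and its polarization in a trivialization\<close>

context
  fixes U t s
  assumes tr: "trivialized E U t s"
begin

interpretation trivialized E U t s by (rule tr)

definition coord_sq where "coord_sq x y = t (act ((0, 1), s (x, y)))"

lemma triv_sq: "x \<in> U \<Longrightarrow> v \<in> fibre E x \<Longrightarrow> t (act ((0, 1), v)) = coord_sq x (t v)"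
  by (simp add: coord_sq_def inv_triv_fibre)

text \<open>\<open>(c, 0) (a, b) = (c a, c b)\<close> makes \<open>g \<mapsto> g.v\<close> homogeneous of degree 1, hence linear.\<close>

lemma triv_act_linear:
  assumes x: "x \<in> U" and v: "v \<in> fibre E x"
  shows "t (act ((a, b), v)) = a *\<^sub>R t v + b *\<^sub>R coord_sq x (t v)"
proof -
  let ?f = "\<lambda>g. t (act (g, v))"
  have vv: "v \<in> vectors E" "bproj E v = x" using v by (simp_all add: fibre_def)
  have J: "charted (euclidean_manifold :: (jet2, jet2) manifold)"
    by (intro charted_euclidean finite_dim_prod finite_dim_real)
  have "smooth_map euclidean_manifold euclidean_manifold ?f"
    by (rule smooth_map_triv[OF J smooth_act_compose[OF J smooth_id_euclidean smooth_map_const[OF J charted(2) vv(1)]]])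
      (use act_preserves_fibre[OF v] x in \<open>simp add: fibre_def\<close>)
  then have "smooth_on UNIV ?f" by (simp add: smooth_map_euclidean_iff)
  moreover have "?f (c *\<^sub>R g) = c *\<^sub>R ?f g" for c g
  proof -
    have "act (c *\<^sub>R g, v) = act ((c, 0), act (g, v))"
      by (cases g) (simp add: act_act[OF vv(1)] jet2_mult_def)
    then show ?thesis using act_preserves_fibre[OF v]
      by (simp add: homothety[OF act_in_vectors[OF vv(1)]] triv_scale[OF x])
  qed
  ultimately have lin: "linear ?f"
    by (intro homogeneous_imp_linear smooth_on_differentiable) auto
  have "?f (a, b) = ?f (a *\<^sub>R (1, 0) + b *\<^sub>R (0, 1))" by simp
  also have "\<dots> = a *\<^sub>R ?f (1, 0) + b *\<^sub>R ?f (0, 1)"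
    unfolding linear_add[OF lin] linear_cmul[OF lin] ..
  also have "?f (1, 0) = t v" using homothety[OF vv(1)] triv_scale[OF x v] by simp
  also have "?f (0, 1) = coord_sq x (t v)" by (rule triv_sq[OF x v])
  finally show ?thesis .
qed

lemma coord_sq_scale:
  assumes x: "x \<in> U"
  shows "coord_sq x (c *\<^sub>R y) = c\<^sup>2 *\<^sub>R coord_sq x y"
proof -
  let ?v = "s (x, y)"
  have v: "?v \<in> fibre E x" "?v \<in> vectors E" using inv_in_fibre[OF x] inv_in_vectors[OF x] by auto
  have "act ((0, 1), vscale E c ?v) = act ((c\<^sup>2, 0), act ((0, 1), ?v))"
    by (simp add: homothety[OF v(2), symmetric] act_act[OF v(2)] jet2_mult_def)
  also have "\<dots> = vscale E (c\<^sup>2) (act ((0, 1), ?v))" by (rule homothety[OF act_in_vectors[OF v(2)]])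
  finally show ?thesis
    unfolding coord_sq_def inv_scale[OF x] using triv_scale[OF x act_preserves_fibre[OF v(1)]] by simp
qed

definition polar_sq where
  "polar_sq x y z = (1/2) *\<^sub>R (coord_sq x (y + z) - coord_sq x y - coord_sq x z)"

text \<open>For fixed \<open>x\<close> the map y to s (x, y) is smooth into the total space, so q
  read in coordinates is a smooth map on the typical fibre and the criterion for degree 2
  applies.\<close>

lemma bilinear_polar_sq:
  assumes x: "x \<in> U"
  shows "bilinear (polar_sq x)"
proof -
  have xB: "x \<in> points (base_mfd E)" using x U_subset by blast
  have "smooth_map euclidean_manifold (total_mfd E) (\<lambda>y. s (x, y))"
    by (rule smooth_map_inv[OF charted(3) smooth_map_const[OF charted(3) charted(1) xB] _ smooth_id_euclidean])
      (rule x)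
  from smooth_act_const[OF charted(3) this]
  have "smooth_map euclidean_manifold euclidean_manifold (\<lambda>y. t (act ((0, 1), s (x, y))))"
    by (rule smooth_map_triv[OF charted(3)])
      (use act_preserves_fibre[OF inv_in_fibre[OF x]] x in \<open>simp add: fibre_def\<close>)
  then have "smooth_on UNIV (coord_sq x)"
    by (simp add: smooth_map_euclidean_iff coord_sq_def[abs_def])
  from homogeneous_2_imp_bilinear_polarization[OF this coord_sq_scale[OF x]]
  show ?thesis by (simp add: polar_sq_def[abs_def])
qed

text \<open>Since q (2 y) = 4 q y, the diagonal value is (4 - 1 - 1)/2 = 1 times q y.\<close>

lemma polar_sq_same:
  assumes x: "x \<in> U"
  shows "polar_sq x y y = coord_sq x y"
proof -
  let ?q = "coord_sq x y"
  have "coord_sq x (y + y) = 4 *\<^sub>R ?q"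
    using coord_sq_scale[OF x, of 2 y] by (simp add: scaleR_2)
  moreover have "4 *\<^sub>R ?q - ?q - ?q = (4 - 1 - 1) *\<^sub>R ?q"
    by (simp only: scaleR_left_diff_distrib scaleR_one)
  ultimately show ?thesis by (simp add: polar_sq_def)
qed

text \<open>\<open>polar_op\<close> is defined without reference to a trivialization, and
  \<open>polar_sq\<close> is its expression in any of them; facts about the typical fibre become
  facts about the global operation this way.\<close>

lemma polar_op_coords:
  assumes x: "x \<in> U" and v: "v \<in> fibre E x" and w: "w \<in> fibre E x"
  shows "polar_op E act (v, w) \<in> fibre E x" "t (polar_op E act (v, w)) = polar_sq x (t v) (t w)"
proof -
  have "(v, w) \<in> points (fibre_square E)" using v w by (simp add: points_fibre_square fibre_def)
  then have *: "polar_op E act (v, w) = vscale E (1/2)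
     (vadd E (act ((0, 1), vadd E v w)) (vscale E (-1) (vadd E (act ((0, 1), v)) (act ((0, 1), w)))))"
    by (simp add: polar_op_def)
  show "polar_op E act (v, w) \<in> fibre E x"
    unfolding * by (intro fibre_closed[OF x] act_preserves_fibre v w)
  show "t (polar_op E act (v, w)) = polar_sq x (t v) (t w)"
    unfolding * polar_sq_def
    by (simp add: triv_scale[OF x] triv_add[OF x] fibre_closed[OF x] act_preserves_fibre v w triv_sq[OF x] algebra_simps)
qed

text \<open>Read off from \<open>(0, 1) (0, 1) = (0, 0)\<close> and \<open>(0, 1) (1, 1) = (0, 1)\<close>.\<close>

lemma polar_sq_cubic:
  assumes x: "x \<in> U"
  shows "polar_sq x y (polar_sq x y y) = 0"
proof -
  let ?q = "coord_sq x" and ?v = "s (x, y)"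
  have v: "?v \<in> fibre E x" "?v \<in> vectors E" using inv_in_fibre[OF x] inv_in_vectors[OF x] by auto
  have "act ((0, 1), act ((0, 1), ?v)) = act ((0, 0), ?v)"
    "act ((0, 1), act ((1, 1), ?v)) = act ((0, 1), ?v)"
    by (simp_all add: act_act[OF v(2)] jet2_mult_def)
  then have "?q (?q y) = 0" "?q (y + ?q y) = ?q y"
    using triv_act_linear[OF x v(1), of 0 0] triv_act_linear[OF x v(1), of 1 1] triv_sq[OF x act_preserves_fibre[OF v(1)]]
      triv_sq[OF x v(1)] triv_inv[OF x]
    by (metis add_0 scaleR_zero_left, metis scaleR_one)
  then show ?thesis by (simp add: polar_sq_same[OF x]) (simp add: polar_sq_def)
qed

end

text \<open>Bilinearity on each fibre does not control how the operation varies with the base point.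
  Joint smoothness comes from the defining formula: q, addition and the two projections are
  smooth.\<close>

lemma smooth_polar_op: "smooth_map (fibre_square E) (total_mfd E) (polar_op E act)"
proof (rule smooth_map_total_via_trivializations[OF vb charted_fibre_square[OF vb] smooth_bproj_fst[OF vb]])
  fix p assume "p \<in> points (fibre_square E)"
  then obtain v w where vw: "p = (v, w)" "v \<in> vectors E" "w \<in> fibre E (bproj E v)"
    by (auto simp: points_fibre_square fibre_def)
  from fibre_trivialized[OF vb vw(2)] obtain U t s where "trivialized E U t s" "bproj E v \<in> U" "v \<in> fibre E (bproj E v)" .
  from polar_op_coords(1)[OF this vw(3)] show "polar_op E act p \<in> fibre E (bproj E (fst p))" by (simp add: vw)
next
  fix U t s
  assume tr: "trivialized E U t s" and o: "openin (mtop (fibre_square E)) (points (fibre_square E) \<inter> (\<lambda>p. bproj E (fst p)) -` U)"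
  interpret trivialized E U t s by (rule tr)
  let ?N = "open_submanifold (fibre_square E) ((\<lambda>p. bproj E (fst p)) -` U)"
  note N = charted_open_submanifold[OF charted_fibre_square[OF vb] o]
  note r = smooth_map_restrict[OF charted_fibre_square[OF vb] charted(2) o]
  note R = charted_euclidean[OF finite_dim_real]
  let ?q = "\<lambda>v. act ((0, 1), v)"
  have pts: "fst p \<in> fibre E (bproj E (fst p))" "snd p \<in> fibre E (bproj E (fst p))" "bproj E (fst p) \<in> U"
    if "p \<in> points ?N" for p
    using that by (auto simp: points_fibre_square fibre_def)
  have "smooth_map ?N euclidean_manifold (\<lambda>p. (1/2) *\<^sub>R (t (?q (case p of (v, w) \<Rightarrow> vadd E v w))
      + (-1) *\<^sub>R (t (?q (fst p)) + t (?q (snd p)))))"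
  proof (intro smooth_map_add[OF N finite_dim_fibre[OF vb]] smooth_map_scaleR[OF N finite_dim_fibre[OF vb]]
      smooth_map_const[OF N R] smooth_map_triv[OF N] smooth_act_const[OF N] r smooth_vadd[OF vb] smooth_fst_snd_fibre_square[OF vb])
    fix p assume p: "p \<in> points ?N"
    note f = act_preserves_fibre[OF fibre_closed(2)[OF pts(3)[OF p] pts(1)[OF p] pts(2)[OF p]]]
      act_preserves_fibre[OF pts(1)[OF p]] act_preserves_fibre[OF pts(2)[OF p]]
    show "bproj E (?q (case p of (v, w) \<Rightarrow> vadd E v w)) \<in> U" "bproj E (?q (fst p)) \<in> U" "bproj E (?q (snd p)) \<in> U"
      using f[of "(0, 1)"] pts(3)[OF p] by (auto simp: fibre_def case_prod_unfold)
  qed simp_all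
  then show "smooth_map ?N euclidean_manifold (\<lambda>p. t (polar_op E act p))"
  proof (rule smooth_map_cong[OF N charted(3)])
    fix p assume p: "p \<in> points ?N"
    note x = pts(3)[OF p] and v = pts(1,2)[OF p]
    show "(1/2) *\<^sub>R (t (?q (case p of (v, w) \<Rightarrow> vadd E v w)) + (-1) *\<^sub>R (t (?q (fst p)) + t (?q (snd p))))
      = t (polar_op E act p)"
      using polar_op_coords(2)[OF tr x v] v
      by (simp add: case_prod_unfold triv_sq[OF tr x] fibre_closed[OF x] triv_add[OF x] polar_sq_def[OF tr] algebra_simps)
  qed
qed

lemma polar_op_in_fibre:
  assumes "x \<in> points (base_mfd E)" "v \<in> fibre E x" "w \<in> fibre E x"
  shows "polar_op E act (v, w) \<in> fibre E x"
proof -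
  from trivialized_at[OF vb assms(1)] obtain U t s where "trivialized E U t s" "x \<in> U" .
  from polar_op_coords(1)[OF this assms(2,3)] show ?thesis .
qed

lemma vzero_in_fibre: "x \<in> points (base_mfd E) \<Longrightarrow> vzero E x \<in> fibre E x"
  using vspace[OF vb] unfolding real_vector_space_ops_def by blast

lemma bilinear_operation_polar_op: "bilinear_operation E (polar_op E act)"
proof -
  let ?m = "polar_op E act"
  have *: "?m (vadd E u v, w) = vadd E (?m (u, w)) (?m (v, w))" "?m (u, vadd E v w) = vadd E (?m (u, v)) (?m (u, w))"
    "?m (vscale E a v, w) = vscale E a (?m (v, w))" "?m (v, vscale E a w) = vscale E a (?m (v, w))"
    if xB: "x \<in> points (base_mfd E)" and uvw: "u \<in> fibre E x" "v \<in> fibre E x" "w \<in> fibre E x" for x u v w a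
  proof -
    from trivialized_at[OF vb xB] obtain U t s where tr: "trivialized E U t s" and x: "x \<in> U" .
    interpret trivialized E U t s by (rule tr)
    note B = bilinear_polar_sq[OF tr x]
    note simps = uvw polar_op_coords[OF tr x] fibre_closed[OF x] triv_add[OF x] triv_scale[OF x]
      bilinear_ladd[OF B] bilinear_radd[OF B] bilinear_lmul[OF B] bilinear_rmul[OF B]
    show "?m (vadd E u v, w) = vadd E (?m (u, w)) (?m (v, w))"
      by (rule triv_eqI[OF x]) (simp_all add: simps)
    show "?m (u, vadd E v w) = vadd E (?m (u, v)) (?m (u, w))"
      by (rule triv_eqI[OF x]) (simp_all add: simps)
    show "?m (vscale E a v, w) = vscale E a (?m (v, w))"
      by (rule triv_eqI[OF x]) (simp_all add: simps)
    show "?m (v, vscale E a w) = vscale E a (?m (v, w))"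
      by (rule triv_eqI[OF x]) (simp_all add: simps)
  qed
  have "?m \<in> extensional (points (fibre_square E))" by (simp add: polar_op_def)
  \<comment> \<open>The facts in \<open>*\<close> speak of three vectors at once; for the scaling
    laws the zero vector of the fibre fills the first place.\<close>
  then show ?thesis
    unfolding bilinear_operation_def
    by (intro conjI ballI allI smooth_polar_op polar_op_in_fibre *(1,2) *(3,4)[where u = "vzero E _"])
      (assumption | rule vzero_in_fibre)+
qed

lemma polar_op_sym_cubic:
  "symmetric_operation E (polar_op E act)"
  "v \<in> vectors E \<Longrightarrow> polar_op E act (v, polar_op E act (v, v)) = vzero E (bproj E v)"
proof -
  let ?m = "polar_op E act"
  have "?m (v, w) = ?m (w, v)" if vw: "v \<in> vectors E" "w \<in> fibre E (bproj E v)" for v w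
  proof -
    from fibre_trivialized[OF vb vw(1)] obtain U t s where tr: "trivialized E U t s" and x: "bproj E v \<in> U"
      and v: "v \<in> fibre E (bproj E v)" .
    interpret trivialized E U t s by (rule tr)
    show ?thesis
      by (rule triv_eqI[OF x]) (simp_all add: polar_op_coords[OF tr x] v vw polar_sq_def[OF tr] add.commute diff_diff_eq)
  qed
  then show "symmetric_operation E ?m"
    unfolding symmetric_operation_def by (auto simp: points_fibre_square fibre_def)
  assume vE: "v \<in> vectors E"
  from fibre_trivialized[OF vb vE] obtain U t s where tr: "trivialized E U t s" and x: "bproj E v \<in> U"
    and v: "v \<in> fibre E (bproj E v)" .
  interpret trivialized E U t s by (rule tr)
  show "?m (v, ?m (v, v)) = vzero E (bproj E v)"
    by (rule triv_eqI[OF x])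
      (simp_all add: polar_op_coords[OF tr x] v fibre_closed[OF x] triv_zero[OF x] polar_sq_cubic[OF tr x])
qed

text \<open>An action is linear in the jet and so determined by q, which the polarization returns on
  the diagonal. Extensionality turns agreement on vectors into equality of functions.\<close>

lemma jet2_act_polar_op: "jet2_act E (polar_op E act) = act"
proof (rule extensionalityI[where A = "UNIV \<times> vectors E"])
  show "jet2_act E (polar_op E act) \<in> extensional (UNIV \<times> vectors E)" by (simp add: jet2_act_def)
  show "act \<in> extensional (UNIV \<times> vectors E)" using act unfolding smooth_jet2_action_def by blast
  fix p :: "jet2 \<times> 'e" assume "p \<in> UNIV \<times> vectors E"
  then obtain a b v where p: "p = ((a, b), v)" "v \<in> vectors E" by auto
  from fibre_trivialized[OF vb p(2)] obtain U t s where tr: "trivialized E U t s" and x: "bproj E v \<in> U"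
    and v: "v \<in> fibre E (bproj E v)" .
  interpret trivialized E U t s by (rule tr)
  show "jet2_act E (polar_op E act) p = act p"
    unfolding p(1) jet2_act_apply[OF p(2)]
    by (rule triv_eqI[OF x])
      (simp_all add: polar_op_coords[OF tr x] v fibre_closed[OF x] triv_add[OF x] triv_scale[OF x]
       act_preserves_fibre triv_act_linear[OF tr x] polar_sq_same[OF tr x])
qed

end

text \<open>Here q v = m (v, v), and the cross terms m (v, w) + m (w, v) of q (v + w) add up to 2 m
  (v, w) by symmetry.\<close>

lemma polar_op_jet2_act:
  assumes vb: "vector_bundle E" and m: "bilinear_operation E m" and sym: "symmetric_operation E m"
  shows "polar_op E (jet2_act E m) = m"
proof (rule extensionalityI[where A = "points (fibre_square E)"])
  show "polar_op E (jet2_act E m) \<in> extensional (points (fibre_square E))" by (simp add: polar_op_def)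
  show "m \<in> extensional (points (fibre_square E))" using m unfolding bilinear_operation_def by blast
  fix p assume p: "p \<in> points (fibre_square E)"
  then obtain v w where vw: "p = (v, w)" "v \<in> vectors E" "w \<in> fibre E (bproj E v)"
    by (auto simp: points_fibre_square fibre_def)
  from fibre_trivialized[OF vb vw(2)] obtain U t s where tr: "trivialized E U t s" and x: "bproj E v \<in> U"
    and v: "v \<in> fibre E (bproj E v)" .
  interpret trivialized E U t s by (rule tr)
  note B = bilinear_coord_op[OF m x]
  have *: "polar_op E (jet2_act E m) p = vscale E (1/2) (vadd E (jet2_act E m ((0, 1), vadd E v w))
      (vscale E (-1) (vadd E (jet2_act E m ((0, 1), v)) (jet2_act E m ((0, 1), w)))))"
    using p by (simp add: polar_op_def vw)
  show "polar_op E (jet2_act E m) p = m p"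
    unfolding * unfolding vw(1)
    by (rule triv_eqI[OF x])
      (simp_all add: v vw fibre_closed[OF x] triv_add[OF x] triv_scale[OF x] op_in_fibre[OF m x] act_in_fibre[OF m x]
        triv_act[OF m x] triv_op[OF x] bilinear_ladd[OF B] bilinear_radd[OF B] coord_op_sym[OF sym x, of "t w" "t v"]
        algebra_simps flip: scaleR_2)
qed

theorem lemma4p6:
  fixes E :: "('p, 'm::real_inner, 'e, 'k::real_inner, 'f::real_inner) vbundle"
  assumes "vector_bundle E"
  shows "bij_betw
    (\<lambda>m. \<lambda>((a, b), v)\<in>UNIV \<times> vectors E. vadd E (vscale E a v) (vscale E b (m (v, v))))
    {m. bilinear_operation E m \<and> symmetric_operation E m \<and>
        (\<forall>v\<in>vectors E. m (v, m (v, v)) = vzero E (bproj E v))}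
    {act. smooth_jet2_action E act \<and> (\<forall>a. \<forall>v\<in>vectors E. act ((a, 0), v) = vscale E a v)}"
  unfolding jet2_act_def[symmetric]
\<comment> \<open>The inverse sends an action to the polarization of q. Cases 1 and 2 are the two
  composites, cases 3 and 4 say that each map lands in the other set.\<close>
proof (rule bij_betw_byWitness[where f' = "polar_op E"], goal_cases)
  case 1
  then show ?case using polar_op_jet2_act[OF assms] by blast
next
  case 2
  then show ?case using jet2_act_polar_op[OF assms] by blast
next
  case 3
  then show ?case using jet2_act_action[OF assms] by auto
next
  case 4
  then show ?case
    using bilinear_operation_polar_op[OF assms] polar_op_sym_cubic[OF assms] by auto
qed

end
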